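(* For graphs $G$ of order $n$, computing the zero forcing graph $\mathscr{Z}(G)$ takes $2^{\Theta(n)}$ operations in the worst case. That is, there is an algorithm which, given any graph $G$ of order $n$, outputs $\mathscr{Z}(G)$ using $2^{O(n)}$ operations, and every algorithm which, given a graph $G$, outputs $\mathscr{Z}(G)$ uses $2^{\Omega(n)}$ operations in the worst case over graphs $G$ of order $n$.
   Context: All graphs are finite, simple and undirected. Operations are elementary computation steps in a standard model of computation; the input $G$ is given as a list of edges, and the output $\mathscr{Z}(G)$ is given explicitly (its vertices and edges are listed). Zero forcing: vertices of a graph $G$ are colored blue or white; the color change rule says that a blue vertex $u$ can change the color of a white vertex $w$ to blue if $w$ is the unique white neighbor of $u$. A set $B\subseteq V(G)$ is a zero forcing set of $G$ if, starting with exactly the vertices of $B$ blue and applying the color change rule repeatedly, all vertices eventually become blue. The zero forcing number $\operatorname{Z}(G)$ is the minimum of $|B|$ over all zero forcing sets $B$ of $G$; a minimum zero forcing set is a zero forcing set $B$ with $|B|=\operatorname{Z}(G)$. The zero forcing graph $\mathscr{Z}(G)$ is the graph whose vertices are the minimum zero forcing sets of $G$, with two of them adjacent if and only if their symmetric difference has exactly two elements. *)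

theory Defs
  imports Complex_Main "HOL-Library.Landau_Symbols"
begin

section \<open>Graphs and zero forcing\<close>

text \<open>A graph is a pair of a vertex set and a set of edges, each edge being a two-element set of
  vertices.\<close>

type_synonym 'a graph = "'a set \<times> 'a set set"

abbreviation verts :: "'a graph \<Rightarrow> 'a set" where "verts G \<equiv> fst G"
abbreviation edges :: "'a graph \<Rightarrow> 'a set set" where "edges G \<equiv> snd G"

definition simple_graph :: "'a graph \<Rightarrow> bool" where
  "simple_graph G \<longleftrightarrow> finite (verts G) \<and> (\<forall>e\<in>edges G. e \<subseteq> verts G \<and> card e = 2)"

text \<open>One application of the color change rule; the second and third arguments are the sets of blue
  vertices before and after.\<close>

definition color_change :: "'a graph \<Rightarrow> 'a set \<Rightarrow> 'a set \<Rightarrow> bool" where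
  "color_change G S S' \<longleftrightarrow>
     (\<exists>u\<in>S. \<exists>w. {x \<in> verts G - S. {u, x} \<in> edges G} = {w} \<and> S' = insert w S)"

definition zero_forcing_set :: "'a graph \<Rightarrow> 'a set \<Rightarrow> bool" where
  "zero_forcing_set G B \<longleftrightarrow> B \<subseteq> verts G \<and> (color_change G)\<^sup>*\<^sup>* B (verts G)"

definition zero_forcing_number :: "'a graph \<Rightarrow> nat" where
  "zero_forcing_number G = (LEAST k. \<exists>B. zero_forcing_set G B \<and> card B = k)"

definition minimum_zero_forcing_set :: "'a graph \<Rightarrow> 'a set \<Rightarrow> bool" where
  "minimum_zero_forcing_set G B \<longleftrightarrow> zero_forcing_set G B \<and> card B = zero_forcing_number G"

definition zero_forcing_graph :: "'a graph \<Rightarrow> 'a set graph" where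
  "zero_forcing_graph G =
     ({B. minimum_zero_forcing_set G B},
      {{B, C} | B C. minimum_zero_forcing_set G B \<and> minimum_zero_forcing_set G C \<and>
                     card (sym_diff B C) = 2})"


section \<open>Random access machines\<close>

text \<open>Following Cook and Reckhow, with natural-number registers, truncated subtraction, and unit
  cost. There is deliberately no multiplication: with it, unit cost would not be polynomially related
  to Turing machine time. \<open>JumpPos i l\<close> jumps to instruction \<open>l\<close> if register \<open>i\<close> is positive.\<close>

datatype instr =
    Const nat nat
  | Add nat nat nat
  | Sub nat nat nat
  | Load nat nat
  | Store nat nat
  | JumpPos nat nat
  | Read nat
  | Print nat

type_synonym program = "instr list"

record config =
  pc :: nat
  reg :: "nat \<Rightarrow> nat"
  inp :: "nat list"
  outp :: "nat list"

text \<open>\<open>Read\<close> yields 0 once the input is exhausted.\<close>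

fun exec :: "instr \<Rightarrow> config \<Rightarrow> config" where
  "exec (Const i k) c = c\<lparr>pc := pc c + 1, reg := (reg c)(i := k)\<rparr>"
| "exec (Add i j k) c = c\<lparr>pc := pc c + 1, reg := (reg c)(i := reg c j + reg c k)\<rparr>"
| "exec (Sub i j k) c = c\<lparr>pc := pc c + 1, reg := (reg c)(i := reg c j - reg c k)\<rparr>"
| "exec (Load i j) c = c\<lparr>pc := pc c + 1, reg := (reg c)(i := reg c (reg c j))\<rparr>"
| "exec (Store i j) c = c\<lparr>pc := pc c + 1, reg := (reg c)(reg c i := reg c j)\<rparr>"
| "exec (JumpPos i l) c = c\<lparr>pc := (if reg c i > 0 then l else pc c + 1)\<rparr>"
| "exec (Read i) c =
     c\<lparr>pc := pc c + 1, reg := (reg c)(i := (case inp c of [] \<Rightarrow> 0 | x # _ \<Rightarrow> x)), inp := tl (inp c)\<rparr>"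
| "exec (Print i) c = c\<lparr>pc := pc c + 1, outp := outp c @ [reg c i]\<rparr>"

definition halted :: "program \<Rightarrow> config \<Rightarrow> bool" where
  "halted P c \<longleftrightarrow> length P \<le> pc c"

definition step :: "program \<Rightarrow> config \<Rightarrow> config" where
  "step P c = (if halted P c then c else exec (P ! pc c) c)"

definition run :: "program \<Rightarrow> nat list \<Rightarrow> nat \<Rightarrow> config" where
  "run P xs t = (step P ^^ t) \<lparr>pc = 0, reg = (\<lambda>_. 0), inp = xs, outp = []\<rparr>"

definition terminates :: "program \<Rightarrow> nat list \<Rightarrow> bool" where
  "terminates P xs \<longleftrightarrow> (\<exists>t. halted P (run P xs t))"

text \<open>The number of operations; meaningful only for terminating runs.\<close>

definition running_time :: "program \<Rightarrow> nat list \<Rightarrow> nat" where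
  "running_time P xs = (LEAST t. halted P (run P xs t))"

definition result :: "program \<Rightarrow> nat list \<Rightarrow> nat list" where
  "result P xs = outp (run P xs (running_time P xs))"


section \<open>Input and output formats\<close>

text \<open>Every edge is listed exactly once, in one of its two orientations.\<close>

definition lists_edges :: "('a \<times> 'a) list \<Rightarrow> 'a set set \<Rightarrow> bool" where
  "lists_edges es E \<longleftrightarrow>
     distinct (map (\<lambda>(u, v). {u, v}) es) \<and> set (map (\<lambda>(u, v). {u, v}) es) = E"

definition encode_pairs :: "(nat \<times> nat) list \<Rightarrow> nat list" where
  "encode_pairs ps = length ps # concat (map (\<lambda>(u, v). [u, v]) ps)"

text \<open>A graph with vertices \<open>0, \<dots>, n - 1\<close> is presented by \<open>n\<close> followed by an edge list; \<open>n\<close> is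
  included because isolated vertices do not occur in the edge list.\<close>

definition graph_inputs :: "nat graph \<Rightarrow> nat list set" where
  "graph_inputs G = {card (verts G) # encode_pairs es | es. lists_edges es (edges G)}"

text \<open>A graph whose vertices are finite sets of natural numbers is output as its number of vertices,
  the vertices one after the other (each as its cardinality followed by its elements), and a list of
  edges, in which a vertex is denoted by its position in the list of vertices.\<close>

definition graph_outputs :: "nat set graph \<Rightarrow> nat list set" where
  "graph_outputs H =
     {length Bs # concat (map (\<lambda>B. length B # B) Bs) @ encode_pairs ps | Bs ps.
        (\<forall>B\<in>set Bs. distinct B) \<and> distinct (map set Bs) \<and> set (map set Bs) = verts H \<and>
        (\<forall>(i, j)\<in>set ps. i < length Bs \<and> j < length Bs) \<and>
        lists_edges (map (\<lambda>(i, j). (set (Bs ! i), set (Bs ! j))) ps) (edges H)}"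

definition inputs_of_order :: "nat \<Rightarrow> nat list set" where
  "inputs_of_order n = (\<Union>G\<in>{G. simple_graph G \<and> verts G = {..<n}}. graph_inputs G)"

definition computes_zero_forcing_graph :: "program \<Rightarrow> bool" where
  "computes_zero_forcing_graph P \<longleftrightarrow>
     (\<forall>G n. simple_graph G \<longrightarrow> verts G = {..<n} \<longrightarrow>
        (\<forall>xs\<in>graph_inputs G.
           terminates P xs \<and> result P xs \<in> graph_outputs (zero_forcing_graph G)))"

text \<open>The maximum is over a finite nonempty set, as shown below.\<close>

definition worst_case_time :: "program \<Rightarrow> nat \<Rightarrow> nat" where
  "worst_case_time P n = Max (running_time P ` inputs_of_order n)"

lemma finite_inputs_of_order: "finite (inputs_of_order n)"
proof -
  let ?A = "{es :: (nat \<times> nat) list. set es \<subseteq> {..<n} \<times> {..<n} \<and> distinct es}"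
  have "inputs_of_order n \<subseteq> (\<lambda>es. n # encode_pairs es) ` ?A"
  proof
    fix xs assume "xs \<in> inputs_of_order n"
    then obtain G es where G: "simple_graph G" "verts G = {..<n}"
      and es: "lists_edges es (edges G)" and xs: "xs = n # encode_pairs es"
      by (auto simp: inputs_of_order_def graph_inputs_def)
    have "distinct es"
      using es by (auto simp: lists_edges_def distinct_map)
    moreover have "u < n \<and> v < n" if "(u, v) \<in> set es" for u v
    proof -
      have "{u, v} \<in> edges G"
        using es that by (force simp: lists_edges_def)
      then show ?thesis
        using G by (auto simp: simple_graph_def)
    qed
    ultimately show "xs \<in> (\<lambda>es. n # encode_pairs es) ` ?A"
      using xs by auto
  qed
  then show ?thesis
    using finite_subset_distinct[of "{..<n} \<times> {..<n}"] finite_subset by blast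
qed

lemma inputs_of_order_nonempty: "inputs_of_order n \<noteq> {}"
proof -
  have "n # encode_pairs [] \<in> graph_inputs ({..<n}, {})"
    by (auto simp: graph_inputs_def lists_edges_def)
  then show ?thesis
    by (force simp: inputs_of_order_def simple_graph_def)
qed

end

theory Submission
  imports Defs "HOL-Library.Countable" "HOL-Library.Nat_Bijection"
begin

text \<open>Upper bound: encode the subsets of \<open>{..<n}\<close> as numbers below \<open>2 ^ n\<close>. A set is zero forcing iff
  it is the whole vertex set or one color change leads from it to a zero forcing set, which has a
  larger number; so a table of the zero forcing sets can be filled in decreasing order, and the minimum
  ones, and the pairs of them at distance two, are found by exhaustive search. The machine code comes
  from a language whose loops have a bound fixed on entry. Running time is then polynomial in any
  common bound of the numbers of iterations, and \<open>4 ^ n\<close> is such a bound.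

  Lower bound: a matching with \<open>n div 2\<close> edges, together with the isolated vertex for odd \<open>n\<close>, has
  \<open>2 ^ (n div 2)\<close> minimum zero forcing sets, one for each choice of an endpoint of every edge, and a
  machine prints at most one number per operation.\<close>

section \<open>A structured language for random access machines\<close>

text \<open>The machine has neither multiplication nor shifts, and this shapes the data structures.
  Powers of two come from repeated doubling and are kept in a table; binary digits are split off by
  greedy subtraction from the top; an edge is looked up under the key \<open>2 ^ u + 2 ^ v\<close>,
  which takes one addition, does not depend on the orientation, and for different ends determines
  the pair. Since termination is built into the language, time is separated from functional
  correctness: only the values of a few loop bounds have to be controlled. Crude estimates suffice,
  because the degree D of the polynomial depends on the program and not on the input, so that
  \<open>(4 ^ n + 1) ^ D\<close> is still 2 to a linear function of n. The base 4 comes from pairs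
  of vertex subsets, which bound the number of edges to be printed. In the lower bound every
  component of the matching must contain an initially blue vertex, which makes all choices of one
  endpoint per edge minimum at once; the vertex list alone is then already long enough.\<close>

datatype ('v, 'a) exp =
    Num nat
  | Var 'v
  | Elem 'a "('v, 'a) exp"
  | Plus "('v, 'a) exp" "('v, 'a) exp"
  | Minus "('v, 'a) exp" "('v, 'a) exp"

datatype ('v, 'a) com =
    Skip
  | Assign 'v "('v, 'a) exp"
  | Update 'a "('v, 'a) exp" "('v, 'a) exp"
  | Input 'v
  | Output "('v, 'a) exp"
  | Seq "('v, 'a) com" "('v, 'a) com"  (infixr ";;" 60)
  | Cond "('v, 'a) exp" "('v, 'a) com" "('v, 'a) com"
  | For 'v 'v "('v, 'a) com"

record ('v, 'a) state =
  vars :: "'v \<Rightarrow> nat"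
  arrs :: "'a \<Rightarrow> nat \<Rightarrow> nat"
  ins :: "nat list"
  outs :: "nat list"

primrec eval :: "('v, 'a) exp \<Rightarrow> ('v, 'a) state \<Rightarrow> nat" where
  "eval (Num k) s = k"
| "eval (Var x) s = vars s x"
| "eval (Elem a e) s = arrs s a (eval e s)"
| "eval (Plus e f) s = eval e s + eval f s"
| "eval (Minus e f) s = eval e s - eval f s"

text \<open>The bound of a loop is evaluated on entry, and the loop variable is reset from a hidden counter
  at the start of each iteration; so every program terminates, whatever its loop bodies assign.\<close>

primrec sem :: "('v, 'a) com \<Rightarrow> ('v, 'a) state \<Rightarrow> ('v, 'a) state" where
  "sem Skip = (\<lambda>s. s)"
| "sem (Assign x e) = (\<lambda>s. s\<lparr>vars := (vars s)(x := eval e s)\<rparr>)"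
| "sem (Update a e f) = (\<lambda>s. s\<lparr>arrs := (arrs s)(a := (arrs s a)(eval e s := eval f s))\<rparr>)"
| "sem (Input x) =
     (\<lambda>s. s\<lparr>vars := (vars s)(x := (case ins s of [] \<Rightarrow> 0 | k # _ \<Rightarrow> k)), ins := tl (ins s)\<rparr>)"
| "sem (Output e) = (\<lambda>s. s\<lparr>outs := outs s @ [eval e s]\<rparr>)"
| "sem (c ;; d) = (\<lambda>s. sem d (sem c s))"
| "sem (Cond e c d) = (\<lambda>s. if eval e s > 0 then sem c s else sem d s)"
| "sem (For i x c) = (\<lambda>s. fold (\<lambda>k s. sem c (s\<lparr>vars := (vars s)(i := k)\<rparr>)) [0..<vars s x] s)"

text \<open>The invariant is indexed by the number of completed iterations and speaks of the state
  before the loop variable is reset, so it never has to mention that variable.\<close>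

lemma sem_For_induct:
  assumes "I 0 s"
    and "\<And>k s'. k < vars s x \<Longrightarrow> I k s' \<Longrightarrow> I (Suc k) (sem c (s'\<lparr>vars := (vars s')(i := k)\<rparr>))"
  shows "I (vars s x) (sem (For i x c) s)"
proof -
  have "k \<le> vars s x \<Longrightarrow>
      I k (fold (\<lambda>k s. sem c (s\<lparr>vars := (vars s)(i := k)\<rparr>)) [0..<k] s)" for k
    by (induction k) (use assms in auto)
  then show ?thesis
    by simp
qed

section \<open>Frame conditions and bounds on the numbers of iterations\<close>

primrec written_vars :: "('v, 'a) com \<Rightarrow> 'v set" where
  "written_vars Skip = {}"
| "written_vars (Assign x e) = {x}"
| "written_vars (Update a e f) = {}"
| "written_vars (Input x) = {x}"
| "written_vars (Output e) = {}"
| "written_vars (c ;; d) = written_vars c \<union> written_vars d"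
| "written_vars (Cond e c d) = written_vars c \<union> written_vars d"
| "written_vars (For i x c) = insert i (written_vars c)"

primrec written_arrs :: "('v, 'a) com \<Rightarrow> 'a set" where
  "written_arrs Skip = {}"
| "written_arrs (Assign x e) = {}"
| "written_arrs (Update a e f) = {a}"
| "written_arrs (Input x) = {}"
| "written_arrs (Output e) = {}"
| "written_arrs (c ;; d) = written_arrs c \<union> written_arrs d"
| "written_arrs (Cond e c d) = written_arrs c \<union> written_arrs d"
| "written_arrs (For i x c) = written_arrs c"

primrec silent :: "('v, 'a) com \<Rightarrow> bool" where
  "silent Skip \<longleftrightarrow> True"
| "silent (Assign x e) \<longleftrightarrow> True"
| "silent (Update a e f) \<longleftrightarrow> True"
| "silent (Input x) \<longleftrightarrow> True"
| "silent (Output e) \<longleftrightarrow> False"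
| "silent (c ;; d) \<longleftrightarrow> silent c \<and> silent d"
| "silent (Cond e c d) \<longleftrightarrow> silent c \<and> silent d"
| "silent (For i x c) \<longleftrightarrow> silent c"

lemma vars_sem: "x \<notin> written_vars c \<Longrightarrow> vars (sem c s) x = vars s x"
proof (induction c arbitrary: s)
  case (For i y c)
  show ?case
    by (rule sem_For_induct[where I = "\<lambda>_ s'. vars s' x = vars s x"]) (use For in auto)
qed auto

lemma arrs_sem: "a \<notin> written_arrs c \<Longrightarrow> arrs (sem c s) a = arrs s a"
proof (induction c arbitrary: s)
  case (For i y c)
  show ?case
    by (rule sem_For_induct[where I = "\<lambda>_ s'. arrs s' a = arrs s a"]) (use For in auto)
qed auto

lemma outs_sem: "silent c \<Longrightarrow> outs (sem c s) = outs s"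
proof (induction c arbitrary: s)
  case (For i y c)
  show ?case
    by (rule sem_For_induct[where I = "\<lambda>_ s'. outs s' = outs s"]) (use For in auto)
qed auto

text \<open>Both branches of a conditional have to be bounded, whichever is taken: no values of
  conditions are then needed to establish the property. In the loop case the fold is the state after
  k iterations, from which the next one starts.\<close>

primrec loops_bounded :: "nat \<Rightarrow> ('v, 'a) com \<Rightarrow> ('v, 'a) state \<Rightarrow> bool" where
  "loops_bounded N Skip s \<longleftrightarrow> True"
| "loops_bounded N (Assign x e) s \<longleftrightarrow> True"
| "loops_bounded N (Update a e f) s \<longleftrightarrow> True"
| "loops_bounded N (Input x) s \<longleftrightarrow> True"
| "loops_bounded N (Output e) s \<longleftrightarrow> True"
| "loops_bounded N (c ;; d) s \<longleftrightarrow> loops_bounded N c s \<and> loops_bounded N d (sem c s)"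
| "loops_bounded N (Cond e c d) s \<longleftrightarrow> loops_bounded N c s \<and> loops_bounded N d s"
| "loops_bounded N (For i x c) s \<longleftrightarrow> vars s x \<le> N \<and>
     (\<forall>k<vars s x. loops_bounded N c
        ((\<lambda>s. s\<lparr>vars := (vars s)(i := k)\<rparr>) (fold (\<lambda>k s. sem c (s\<lparr>vars := (vars s)(i := k)\<rparr>)) [0..<k] s)))"

primrec bound_vars :: "('v, 'a) com \<Rightarrow> 'v set" where
  "bound_vars Skip = {}"
| "bound_vars (Assign x e) = {}"
| "bound_vars (Update a e f) = {}"
| "bound_vars (Input x) = {}"
| "bound_vars (Output e) = {}"
| "bound_vars (c ;; d) = bound_vars c \<union> bound_vars d"
| "bound_vars (Cond e c d) = bound_vars c \<union> bound_vars d"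
| "bound_vars (For i x c) = insert x (bound_vars c)"

text \<open>Loop bounds that the command never assigns keep their entry values through all nested
  loops, so inspecting the entry state suffices and no invariant of the computation is
  required.\<close>

lemma loops_boundedI:
  assumes "bound_vars c \<subseteq> X" "written_vars c \<inter> X = {}" "\<And>x. x \<in> X \<Longrightarrow> vars s x \<le> N"
  shows "loops_bounded N c s"
  using assms
proof (induction c arbitrary: s)
  case (Seq c d)
  have "vars (sem c s) x \<le> N" if "x \<in> X" for x
    using Seq.prems that by (subst vars_sem) auto
  with Seq show ?case
    by (auto simp: Int_Un_distrib2)
next
  case (For i y c)
  have "vars (fold (\<lambda>k s. sem c (s\<lparr>vars := (vars s)(i := k)\<rparr>)) [0..<k] s) x \<le> N" if "x \<in> X" for x k
  proof (induction k)
    case (Suc k)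
    have "x \<notin> written_vars c" "x \<noteq> i"
      using For.prems(2) that by auto
    then show ?case
      using Suc by (simp add: vars_sem)
  qed (use that For.prems in auto)
  moreover have "i \<notin> X"
    using For.prems by auto
  ultimately have "loops_bounded N c
      ((\<lambda>s. s\<lparr>vars := (vars s)(i := k)\<rparr>) (fold (\<lambda>k s. sem c (s\<lparr>vars := (vars s)(i := k)\<rparr>)) [0..<k] s))"
    for k
    using For.prems by (intro For.IH) auto
  then show ?case
    using For.prems by auto
qed (auto simp: Int_Un_distrib2)

section \<open>Compilation\<close>

text \<open>\<open>T\<close> is only an upper bound for the number of steps, since the two branches
  of a conditional take different times.\<close>

definition reaches :: "program \<Rightarrow> nat \<Rightarrow> config \<Rightarrow> config \<Rightarrow> bool" where
  "reaches P T c c' \<longleftrightarrow> (\<exists>t\<le>T. (step P ^^ t) c = c')"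

lemma reaches_refl: "reaches P T c c"
  by (auto simp: reaches_def intro: exI[of _ 0])

lemma reaches_mono: "reaches P T c c' \<Longrightarrow> T \<le> T' \<Longrightarrow> reaches P T' c c'"
  unfolding reaches_def by (metis order_trans)

lemma reaches_trans: "reaches P T c c' \<Longrightarrow> reaches P T' c' c'' \<Longrightarrow> reaches P (T + T') c c''"
  unfolding reaches_def
proof clarify
  fix t t' assume "t \<le> T" "t' \<le> T'"
  then show "\<exists>u\<le>T + T'. (step P ^^ u) c = (step P ^^ t') ((step P ^^ t) c)"
    by (intro exI[of _ "t' + t"]) (simp add: funpow_add)
qed

text \<open>Jump targets are absolute, so compiled fragments are always considered at a fixed offset
  of a surrounding program.\<close>

definition code_at :: "program \<Rightarrow> nat \<Rightarrow> program \<Rightarrow> bool" where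
  "code_at P b q \<longleftrightarrow> (\<forall>i<length q. b + i < length P \<and> P ! (b + i) = q ! i)"

lemma code_at_Nil [simp]: "code_at P b []"
  by (simp add: code_at_def)

lemma code_at_Cons [simp]:
  "code_at P b (i # q) \<longleftrightarrow> b < length P \<and> P ! b = i \<and> code_at P (Suc b) q"
  by (auto simp: code_at_def less_Suc_eq_0_disj nth_Cons split: nat.splits)

lemma code_at_append [simp]:
  "code_at P b (q @ r) \<longleftrightarrow> code_at P b q \<and> code_at P (b + length q) r"
  by (induction q arbitrary: b) auto

lemma reaches_exec:
  assumes "code_at P b (i # q)" "pc c = b"
  shows "reaches P 1 c (exec i c)"
  using assms by (auto simp: reaches_def step_def halted_def intro!: exI[of _ 1])

primrec is_jump :: "instr \<Rightarrow> bool" where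
  "is_jump (Const i k) = False"
| "is_jump (Add i j k) = False"
| "is_jump (Sub i j k) = False"
| "is_jump (Load i j) = False"
| "is_jump (Store i j) = False"
| "is_jump (JumpPos i l) = True"
| "is_jump (Read i) = False"
| "is_jump (Print i) = False"

lemma pc_exec: "\<not> is_jump i \<Longrightarrow> pc (exec i c) = Suc (pc c)"
  by (cases i) auto

lemma pc_fold_exec: "\<forall>i\<in>set q. \<not> is_jump i \<Longrightarrow> pc (fold exec q c) = pc c + length q"
  by (induction q arbitrary: c) (auto simp: pc_exec)

text \<open>Without jumps the program counter merely advances, so the effect of a block is a plain
  fold that rewriting can evaluate.\<close>

lemma reaches_fold_exec:
  assumes "code_at P b q" "pc c = b" "\<forall>i\<in>set q. \<not> is_jump i"
  shows "reaches P (length q) c (fold exec q c)"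
  using assms
proof (induction q arbitrary: b c)
  case (Cons i q)
  have "reaches P 1 c (exec i c)"
    using Cons.prems by (intro reaches_exec) auto
  moreover have "reaches P (length q) (exec i c) (fold exec q (exec i c))"
    using Cons.prems by (intro Cons.IH[of "Suc b"]) (auto simp: pc_exec)
  ultimately show ?case
    using reaches_trans by force
qed (simp add: reaches_refl)

text \<open>Every positive number is uniquely of the form \<open>2 ^ k * (2 * i + 1)\<close>. The exponent separates
  the variables, the loop counters, the temporaries and the arrays.\<close>

definition addr :: "nat \<Rightarrow> nat \<Rightarrow> nat" where
  "addr k i = 2 ^ k * (2 * i + 1)"

lemma addr_eq_iff [simp]: "addr k i = addr l j \<longleftrightarrow> k = l \<and> i = j"
proof
  assume "addr k i = addr l j"
  then show "k = l \<and> i = j"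
    unfolding addr_def
  proof (induction k arbitrary: l)
    case 0
    then show ?case
      by (cases l) (auto, presburger)
  next
    case (Suc k)
    show ?case
    proof (cases l)
      case 0
      then show ?thesis
        using Suc.prems by (auto, presburger)
    next
      case (Suc l')
      with Suc.prems Suc.IH[of l'] show ?thesis
        by simp
    qed
  qed
qed simp

abbreviation var_reg :: "'v::countable \<Rightarrow> nat" where "var_reg x \<equiv> addr 0 (to_nat x)"
abbreviation ctr_reg :: "nat \<Rightarrow> nat" where "ctr_reg \<equiv> addr (Suc 0)"
abbreviation tmp_reg :: "nat \<Rightarrow> nat" where "tmp_reg \<equiv> addr (Suc (Suc 0))"
abbreviation arr_reg :: "'a::countable \<Rightarrow> nat \<Rightarrow> nat" where
  "arr_reg a \<equiv> addr (Suc (Suc (Suc (to_nat a))))"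

definition addr_code :: "nat \<Rightarrow> nat \<Rightarrow> program" where
  "addr_code k d = [Add (tmp_reg d) (tmp_reg d) (tmp_reg d), Const (tmp_reg (Suc d)) 1,
      Add (tmp_reg d) (tmp_reg d) (tmp_reg (Suc d))] @
    replicate k (Add (tmp_reg d) (tmp_reg d) (tmp_reg d))"

text \<open>The temporaries form an evaluation stack of which \<open>d\<close> is the current
  height; the value is left in temporary \<open>d\<close>. Copying a register is done by adding
  zero.\<close>

primrec compile_exp :: "('v::countable, 'a::countable) exp \<Rightarrow> nat \<Rightarrow> program" where
  "compile_exp (Num k) d = [Const (tmp_reg d) k]"
| "compile_exp (Var x) d =
     [Const (tmp_reg (Suc d)) 0, Add (tmp_reg d) (var_reg x) (tmp_reg (Suc d))]"
| "compile_exp (Elem a e) d =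
     compile_exp e d @ addr_code (Suc (Suc (Suc (to_nat a)))) d @ [Load (tmp_reg d) (tmp_reg d)]"
| "compile_exp (Plus e f) d =
     compile_exp e d @ compile_exp f (Suc d) @ [Add (tmp_reg d) (tmp_reg d) (tmp_reg (Suc d))]"
| "compile_exp (Minus e f) d =
     compile_exp e d @ compile_exp f (Suc d) @ [Sub (tmp_reg d) (tmp_reg d) (tmp_reg (Suc d))]"

definition represents :: "config \<Rightarrow> ('v::countable, 'a::countable) state \<Rightarrow> bool" where
  "represents c s \<longleftrightarrow> (\<forall>x. reg c (var_reg x) = vars s x) \<and>
     (\<forall>a i. reg c (arr_reg a i) = arrs s a i) \<and> inp c = ins s \<and> outp c = outs s"

text \<open>Evaluation at height \<open>d\<close> may overwrite temporaries from \<open>d\<close>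
  upwards only. This is why the first operand, kept at \<open>d\<close>, survives the evaluation of
  the second at \<open>Suc d\<close>.\<close>

definition same_upto_tmps :: "nat \<Rightarrow> config \<Rightarrow> config \<Rightarrow> bool" where
  "same_upto_tmps d c c' \<longleftrightarrow> inp c' = inp c \<and> outp c' = outp c \<and>
     (\<forall>r. (\<forall>j\<ge>d. r \<noteq> tmp_reg j) \<longrightarrow> reg c' r = reg c r)"

lemma same_upto_tmps_trans:
  "same_upto_tmps d c c' \<Longrightarrow> same_upto_tmps e c' c'' \<Longrightarrow> d \<le> e \<Longrightarrow> same_upto_tmps d c c''"
  unfolding same_upto_tmps_def by (metis order_trans)

lemma same_upto_tmps_represents:
  "same_upto_tmps d c c' \<Longrightarrow> represents c' s \<longleftrightarrow> represents c s"
  by (auto simp: same_upto_tmps_def represents_def)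

lemma same_upto_tmps_ctr: "same_upto_tmps d c c' \<Longrightarrow> reg c' (ctr_reg j) = reg c (ctr_reg j)"
  by (auto simp: same_upto_tmps_def)

lemma same_upto_tmps_tmp: "same_upto_tmps d c c' \<Longrightarrow> j < d \<Longrightarrow> reg c' (tmp_reg j) = reg c (tmp_reg j)"
  by (auto simp: same_upto_tmps_def)

lemma addr_code_no_jump: "\<forall>i\<in>set (addr_code k d). \<not> is_jump i"
  by (auto simp: addr_code_def)

lemma addr_code_correct:
  "reg (fold exec (addr_code k d) c) (tmp_reg d) = addr k (reg c (tmp_reg d))"
  "same_upto_tmps d c (fold exec (addr_code k d) c)"
proof -
  define c0 where "c0 = fold exec [Add (tmp_reg d) (tmp_reg d) (tmp_reg d),
    Const (tmp_reg (Suc d)) 1, Add (tmp_reg d) (tmp_reg d) (tmp_reg (Suc d))] c"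
  have c0: "reg c0 (tmp_reg d) = 2 * reg c (tmp_reg d) + 1" "same_upto_tmps d c c0"
    by (auto simp: c0_def same_upto_tmps_def)
  define c1 where "c1 k = fold exec (replicate k (Add (tmp_reg d) (tmp_reg d) (tmp_reg d))) c0" for k
  have "reg (c1 k) (tmp_reg d) = 2 ^ k * reg c0 (tmp_reg d) \<and> same_upto_tmps d c (c1 k)"
  proof (induction k)
    case (Suc k)
    have "c1 (Suc k) = exec (Add (tmp_reg d) (tmp_reg d) (tmp_reg d)) (c1 k)"
      by (simp add: c1_def replicate_append_same[symmetric] del: replicate_Suc exec.simps
          flip: replicate_Suc)
    with Suc show ?case
      by (auto simp: same_upto_tmps_def)
  qed (use c0 in \<open>auto simp: c1_def\<close>)
  moreover have "fold exec (addr_code k d) c = c1 k"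
    by (simp add: c1_def c0_def addr_code_def)
  ultimately show "reg (fold exec (addr_code k d) c) (tmp_reg d) = addr k (reg c (tmp_reg d))"
    "same_upto_tmps d c (fold exec (addr_code k d) c)"
    using c0 by (auto simp: addr_def)
qed

lemma compile_exp_no_jump: "\<forall>i\<in>set (compile_exp e d). \<not> is_jump i"
  by (induction e arbitrary: d) (use addr_code_no_jump in auto)

lemma compile_exp_correct:
  assumes "represents c s"
  shows "reg (fold exec (compile_exp e d) c) (tmp_reg d) = eval e s"
    and "same_upto_tmps d c (fold exec (compile_exp e d) c)"
proof -
  have "reg (fold exec (compile_exp e d) c) (tmp_reg d) = eval e s \<and>
      same_upto_tmps d c (fold exec (compile_exp e d) c)"
    using assms
  proof (induction e arbitrary: c d)
    case (Elem a e)
    define c1 where "c1 = fold exec (compile_exp e d) c"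
    define c2 where "c2 = fold exec (addr_code (Suc (Suc (Suc (to_nat a)))) d) c1"
    have 1: "reg c1 (tmp_reg d) = eval e s" "same_upto_tmps d c c1"
      using Elem by (auto simp: c1_def)
    have 2: "reg c2 (tmp_reg d) = arr_reg a (eval e s)" "same_upto_tmps d c1 c2"
      using addr_code_correct[where c = c1] 1 by (auto simp: c2_def)
    have "same_upto_tmps d c c2"
      using 1 2 same_upto_tmps_trans by blast
    then show ?case
      using Elem.prems 2
      by (auto simp: c1_def[symmetric] c2_def[symmetric] same_upto_tmps_def represents_def)
  next
    case (Plus e f)
    define c1 where "c1 = fold exec (compile_exp e d) c"
    define c2 where "c2 = fold exec (compile_exp f (Suc d)) c1"
    have 1: "reg c1 (tmp_reg d) = eval e s" "same_upto_tmps d c c1"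
      using Plus by (auto simp: c1_def)
    have "represents c1 s"
      using Plus.prems same_upto_tmps_represents[OF 1(2)] by blast
    then have 2: "reg c2 (tmp_reg (Suc d)) = eval f s" "same_upto_tmps (Suc d) c1 c2"
      using Plus.IH by (auto simp: c2_def)
    have 3: "same_upto_tmps d c c2"
      using 1 2 same_upto_tmps_trans by (metis le_SucI order_refl)
    have 4: "reg c2 (tmp_reg d) = eval e s"
      using 1 2 same_upto_tmps_tmp by auto
    show ?case
      using 2 3 4 by (auto simp: c1_def[symmetric] c2_def[symmetric] same_upto_tmps_def)
  next
    case (Minus e f)
    define c1 where "c1 = fold exec (compile_exp e d) c"
    define c2 where "c2 = fold exec (compile_exp f (Suc d)) c1"
    have 1: "reg c1 (tmp_reg d) = eval e s" "same_upto_tmps d c c1"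
      using Minus by (auto simp: c1_def)
    have "represents c1 s"
      using Minus.prems same_upto_tmps_represents[OF 1(2)] by blast
    then have 2: "reg c2 (tmp_reg (Suc d)) = eval f s" "same_upto_tmps (Suc d) c1 c2"
      using Minus.IH by (auto simp: c2_def)
    have 3: "same_upto_tmps d c c2"
      using 1 2 same_upto_tmps_trans by (metis le_SucI order_refl)
    have 4: "reg c2 (tmp_reg d) = eval e s"
      using 1 2 same_upto_tmps_tmp by auto
    show ?case
      using 2 3 4 by (auto simp: c1_def[symmetric] c2_def[symmetric] same_upto_tmps_def)
  qed (auto simp: same_upto_tmps_def represents_def)
  then show "reg (fold exec (compile_exp e d) c) (tmp_reg d) = eval e s"
    and "same_upto_tmps d c (fold exec (compile_exp e d) c)"
    by auto
qed

lemma reaches_comp_exp: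
  assumes "code_at P b (compile_exp e d)" "pc c = b" "represents c s"
  obtains c' where "reaches P (length (compile_exp e d)) c c'" "pc c' = b + length (compile_exp e d)"
    "represents c' s" "reg c' (tmp_reg d) = eval e s" "same_upto_tmps d c c'"
proof
  let ?c = "fold exec (compile_exp e d) c"
  show "reaches P (length (compile_exp e d)) c ?c"
    using reaches_fold_exec[OF assms(1,2) compile_exp_no_jump] .
  show "pc ?c = b + length (compile_exp e d)"
    using assms(2) by (simp add: pc_fold_exec compile_exp_no_jump)
  show "reg ?c (tmp_reg d) = eval e s" "same_upto_tmps d c ?c"
    using compile_exp_correct[OF assms(3)] by auto
  then show "represents ?c s"
    using assms(3) same_upto_tmps_represents by blast
qed

text \<open>Here \<open>d\<close> is the loop nesting depth and \<open>b\<close> the address of the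
  first instruction. A loop at depth \<open>d\<close> owns two counters: number \<open>2 * d\<close>
  holds the bound copied on entry, number \<open>2 * d + 1\<close> the completed iterations; neither
  is accessible to the source program. Setting a temporary to 1 before \<open>JumpPos\<close> makes
  the jump unconditional. In a loop the test sits at \<open>b + 3\<close>, the exit at
  \<open>b + 5\<close>, the entry at \<open>b + 7\<close> and the body at
  \<open>b + 9\<close>.\<close>

primrec compile :: "('v::countable, 'a::countable) com \<Rightarrow> nat \<Rightarrow> nat \<Rightarrow> program" where
  "compile Skip d b = []"
| "compile (Assign x e) d b =
     compile_exp e 0 @ [Const (tmp_reg 1) 0, Add (var_reg x) (tmp_reg 0) (tmp_reg 1)]"
| "compile (Update a e f) d b =
     compile_exp e 0 @ addr_code (Suc (Suc (Suc (to_nat a)))) 0 @ compile_exp f 1 @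
     [Store (tmp_reg 0) (tmp_reg 1)]"
| "compile (Input x) d b = [Read (var_reg x)]"
| "compile (Output e) d b = compile_exp e 0 @ [Print (tmp_reg 0)]"
| "compile (c ;; c') d b = compile c d b @ compile c' d (b + length (compile c d b))"
| "compile (Cond e c c') d b =
    (let l1 = b + length (compile_exp e 0) + 1;
         l2 = l1 + length (compile c' d l1) + 2;
         l3 = l2 + length (compile c d l2)
     in compile_exp e 0 @ JumpPos (tmp_reg 0) l2 # compile c' d l1 @
        Const (tmp_reg 0) 1 # JumpPos (tmp_reg 0) l3 # compile c d l2)"
| "compile (For i x c) d b =
    [Const (tmp_reg 0) 0, Add (ctr_reg (2 * d)) (var_reg x) (tmp_reg 0),
     Const (ctr_reg (2 * d + 1)) 0,
     Sub (tmp_reg 0) (ctr_reg (2 * d)) (ctr_reg (2 * d + 1)), JumpPos (tmp_reg 0) (b + 7),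
     Const (tmp_reg 0) 1, JumpPos (tmp_reg 0) (b + 9 + length (compile c (Suc d) (b + 9)) + 3),
     Const (tmp_reg 0) 0, Add (var_reg i) (ctr_reg (2 * d + 1)) (tmp_reg 0)] @
    compile c (Suc d) (b + 9) @
    [Const (tmp_reg 0) 1, Add (ctr_reg (2 * d + 1)) (ctr_reg (2 * d + 1)) (tmp_reg 0),
     JumpPos (tmp_reg 0) (b + 3)]"

text \<open>The first 7 of a loop counts test (2), entry (2) and return (3) of one iteration; the
  second counts the prologue (3), the final failing test (2) and the exit (2). For a conditional
  both branches are added, which is generous but keeps the bound independent of the state.\<close>

primrec time_bound :: "nat \<Rightarrow> ('v::countable, 'a::countable) com \<Rightarrow> nat" where
  "time_bound N Skip = 0"
| "time_bound N (Assign x e) = length (compile_exp e 0) + 2"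
| "time_bound N (Update a e f) =
     length (compile_exp e 0) + length (addr_code (Suc (Suc (Suc (to_nat a)))) 0) +
     length (compile_exp f 1) + 1"
| "time_bound N (Input x) = 1"
| "time_bound N (Output e) = length (compile_exp e 0) + 1"
| "time_bound N (c ;; c') = time_bound N c + time_bound N c'"
| "time_bound N (Cond e c c') = length (compile_exp e 0) + 3 + time_bound N c + time_bound N c'"
| "time_bound N (For i x c) = N * (time_bound N c + 7) + 7"

text \<open>The counters below \<open>2 * d\<close> belong to the enclosing loops, so these are the
  ones that code at depth \<open>d\<close> has to preserve.\<close>

definition same_ctrs :: "nat \<Rightarrow> config \<Rightarrow> config \<Rightarrow> bool" where
  "same_ctrs d c c' \<longleftrightarrow> (\<forall>j<2 * d. reg c' (ctr_reg j) = reg c (ctr_reg j))"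

lemma same_ctrs_trans: "same_ctrs d c c' \<Longrightarrow> same_ctrs d c' c'' \<Longrightarrow> same_ctrs d c c''"
  by (auto simp: same_ctrs_def)

lemma same_upto_tmps_same_ctrs: "same_upto_tmps k c c' \<Longrightarrow> same_ctrs d c c'"
  by (auto simp: same_ctrs_def same_upto_tmps_ctr)

definition simulates ::
    "program \<Rightarrow> nat \<Rightarrow> nat \<Rightarrow> config \<Rightarrow> nat \<Rightarrow> ('v::countable, 'a::countable) state \<Rightarrow> bool" where
  "simulates P T d c b s \<longleftrightarrow>
     (\<exists>c'. reaches P T c c' \<and> pc c' = b \<and> represents c' s \<and> same_ctrs d c c')"

lemma simulatesI:
  "reaches P T c c' \<Longrightarrow> pc c' = b \<Longrightarrow> represents c' s \<Longrightarrow> same_ctrs d c c' \<Longrightarrow> simulates P T d c b s"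
  by (auto simp: simulates_def)

lemma simulates_before:
  "reaches P T c c' \<Longrightarrow> same_ctrs d c c' \<Longrightarrow> simulates P T' d c' b s \<Longrightarrow> simulates P (T + T') d c b s"
  unfolding simulates_def by (metis reaches_trans same_ctrs_trans)

lemma simulates_mono: "simulates P T d c b s \<Longrightarrow> T \<le> T' \<Longrightarrow> simulates P T' d c b s"
  unfolding simulates_def using reaches_mono by blast

text \<open>Induction on the command for all offsets, depths and states. Between commands only the
  represented state and the counters of enclosing loops matter; temporaries carry no information
  across a command boundary.\<close>

lemma compile_correct:
  assumes "code_at P b (compile p d b)" "pc c = b" "represents c s" "loops_bounded N p s"
  shows "simulates P (time_bound N p) d c (b + length (compile p d b)) (sem p s)"
  using assms
proof (induction p arbitrary: d b c s)
  case Skip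
  then show ?case
    by (auto simp: same_ctrs_def intro!: simulatesI reaches_refl)
next
  case (Assign x e)
  from Assign.prems obtain c1 where
    c1: "reaches P (length (compile_exp e 0)) c c1" "pc c1 = b + length (compile_exp e 0)"
    "represents c1 s" "reg c1 (tmp_reg 0) = eval e s" "same_upto_tmps 0 c c1"
    by (auto elim!: reaches_comp_exp)
  let ?q = "[Const (tmp_reg 1) 0, Add (var_reg x) (tmp_reg 0) (tmp_reg 1)]"
  have "reaches P (length ?q) c1 (fold exec ?q c1)"
    using Assign.prems c1 by (intro reaches_fold_exec) auto
  from reaches_trans[OF c1(1) this] show ?case
  proof (rule simulatesI[OF reaches_mono])
    show "represents (fold exec ?q c1) (sem (Assign x e) s)"
      using c1 by (auto simp: represents_def)
    show "same_ctrs d c (fold exec ?q c1)"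
      using same_upto_tmps_same_ctrs[OF c1(5), of d] by (auto simp: same_ctrs_def)
  qed (use c1 in auto)
next
  case (Update a e f)
  from Update.prems obtain c1 where
    c1: "reaches P (length (compile_exp e 0)) c c1" "pc c1 = b + length (compile_exp e 0)"
    "represents c1 s" "reg c1 (tmp_reg 0) = eval e s" "same_upto_tmps 0 c c1"
    by (auto elim!: reaches_comp_exp)
  let ?k = "Suc (Suc (Suc (to_nat a)))"
  define c2 where "c2 = fold exec (addr_code ?k 0) c1"
  have c2: "reaches P (length (addr_code ?k 0)) c1 c2"
    "pc c2 = b + length (compile_exp e 0) + length (addr_code ?k 0)"
    unfolding c2_def using Update.prems c1 addr_code_no_jump
    by (auto intro!: reaches_fold_exec simp: pc_fold_exec)
  have c2': "reg c2 (tmp_reg 0) = arr_reg a (eval e s)" "same_upto_tmps 0 c1 c2"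
    using addr_code_correct[where c = c1] c1 by (auto simp: c2_def)
  then have "represents c2 s"
    using c1 same_upto_tmps_represents by blast
  moreover have "code_at P (pc c2) (compile_exp f 1)"
    using Update.prems c2 by (simp add: add.assoc)
  ultimately obtain c3 where
    c3: "reaches P (length (compile_exp f 1)) c2 c3" "pc c3 = pc c2 + length (compile_exp f 1)"
    "represents c3 s" "reg c3 (tmp_reg 1) = eval f s" "same_upto_tmps 1 c2 c3"
    using reaches_comp_exp by metis
  \<comment> \<open>The address waits in temporary 0 while the value to be stored is evaluated at
    height 1.\<close>
  have tmp0: "reg c3 (tmp_reg 0) = arr_reg a (eval e s)"
    using same_upto_tmps_tmp[OF c3(5), of 0] c2' by simp
  let ?i = "Store (tmp_reg 0) (tmp_reg 1)"
  have "reaches P 1 c3 (exec ?i c3)"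
    using Update.prems c2 c3 by (intro reaches_exec[where q = "[]"]) (auto simp: add.assoc)
  from reaches_trans[OF reaches_trans[OF reaches_trans[OF c1(1) c2(1)] c3(1)] this] show ?case
  proof (rule simulatesI[OF reaches_mono])
    show "represents (exec ?i c3) (sem (Update a e f) s)"
      using c3 tmp0 by (auto simp: represents_def)
    show "same_ctrs d c (exec ?i c3)"
      using same_upto_tmps_same_ctrs[OF c1(5), of d] same_upto_tmps_same_ctrs[OF c2'(2), of d]
        same_upto_tmps_same_ctrs[OF c3(5), of d] tmp0 by (auto simp: same_ctrs_def)
  qed (use c2 c3 in auto)
next
  case (Input x)
  let ?i = "Read (var_reg x)"
  have "reaches P 1 c (exec ?i c)"
    using Input.prems by (intro reaches_exec[where q = "[]"]) auto
  then show ?case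
  proof (rule simulatesI[OF reaches_mono])
    show "represents (exec ?i c) (sem (Input x) s)"
      using Input.prems by (auto simp: represents_def)
  qed (use Input.prems in \<open>auto simp: same_ctrs_def\<close>)
next
  case (Output e)
  from Output.prems obtain c1 where
    c1: "reaches P (length (compile_exp e 0)) c c1" "pc c1 = b + length (compile_exp e 0)"
    "represents c1 s" "reg c1 (tmp_reg 0) = eval e s" "same_upto_tmps 0 c c1"
    by (auto elim!: reaches_comp_exp)
  let ?i = "Print (tmp_reg 0)"
  have "reaches P 1 c1 (exec ?i c1)"
    using Output.prems c1 by (intro reaches_exec[where q = "[]"]) auto
  from reaches_trans[OF c1(1) this] show ?case
  proof (rule simulatesI[OF reaches_mono])
    show "represents (exec ?i c1) (sem (Output e) s)"
      using c1 by (auto simp: represents_def)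
    show "same_ctrs d c (exec ?i c1)"
      using same_upto_tmps_same_ctrs[OF c1(5), of d] by (auto simp: same_ctrs_def)
  qed (use c1 in auto)
next
  case (Seq p q)
  have "simulates P (time_bound N p) d c (b + length (compile p d b)) (sem p s)"
    using Seq.prems by (intro Seq.IH) auto
  then obtain c1 where c1: "reaches P (time_bound N p) c c1" "pc c1 = b + length (compile p d b)"
    "represents c1 (sem p s)" "same_ctrs d c c1"
    by (auto simp: simulates_def)
  have "simulates P (time_bound N q) d c1
      (b + length (compile p d b) + length (compile q d (b + length (compile p d b)))) (sem q (sem p s))"
    using Seq.prems c1 by (intro Seq.IH) auto
  from simulates_before[OF c1(1,4) this] show ?case
    by (simp add: add.assoc)
next
  case (Cond e p q)
  define l1 where "l1 = b + length (compile_exp e 0) + 1"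
  define l2 where "l2 = l1 + length (compile q d l1) + 2"
  define l3 where "l3 = l2 + length (compile p d l2)"
  have code_eq: "compile (Cond e p q) d b = compile_exp e 0 @ JumpPos (tmp_reg 0) l2 # compile q d l1 @
        Const (tmp_reg 0) 1 # JumpPos (tmp_reg 0) l3 # compile p d l2"
    by (simp add: Let_def l1_def l2_def l3_def)
  have len: "b + length (compile (Cond e p q) d b) = l3"
    unfolding code_eq by (simp add: l1_def l2_def l3_def)
  have code: "code_at P b (compile_exp e 0)" "l1 - 1 < length P" "P ! (l1 - 1) = JumpPos (tmp_reg 0) l2"
    "code_at P l1 (compile q d l1)"
    "code_at P (l2 - 2) [Const (tmp_reg 0) 1, JumpPos (tmp_reg 0) l3]" "code_at P l2 (compile p d l2)"
    using Cond.prems(1) unfolding code_eq by (simp_all add: l1_def l2_def)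
  obtain c1 where
    c1: "reaches P (length (compile_exp e 0)) c c1" "pc c1 = b + length (compile_exp e 0)"
    "represents c1 s" "reg c1 (tmp_reg 0) = eval e s" "same_upto_tmps 0 c c1"
    using reaches_comp_exp[OF code(1) Cond.prems(2,3)] by metis
  define c2 where "c2 = exec (JumpPos (tmp_reg 0) l2) c1"
  have c2: "reaches P 1 c1 c2"
    unfolding c2_def using code c1
    by (intro reaches_exec[where q = "[]" and b = "l1 - 1"]) (auto simp: l1_def)
  have rep2: "represents c2 s" "same_ctrs d c c2" "pc c2 = (if eval e s > 0 then l2 else l1)"
    using same_upto_tmps_same_ctrs[OF c1(5), of d] c1
    by (auto simp: represents_def same_ctrs_def c2_def l1_def)
  have bounded: "loops_bounded N p s" "loops_bounded N q s"
    using Cond.prems by auto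
  have "simulates P (2 + time_bound N p + time_bound N q) d c2 l3 (sem (Cond e p q) s)"
  proof (cases "eval e s > 0")
    case True
    then have "simulates P (time_bound N p) d c2 (l2 + length (compile p d l2)) (sem p s)"
      using rep2 code bounded by (intro Cond.IH) auto
    with True show ?thesis
      by (auto intro: simulates_mono simp: l3_def)
  next
    case False
    then have "simulates P (time_bound N q) d c2 (l1 + length (compile q d l1)) (sem q s)"
      using rep2 code bounded by (intro Cond.IH) auto
    then obtain c3 where c3: "reaches P (time_bound N q) c2 c3" "pc c3 = l1 + length (compile q d l1)"
      "represents c3 (sem q s)" "same_ctrs d c2 c3"
      by (auto simp: simulates_def)
    define c4 where "c4 = exec (Const (tmp_reg 0) 1) c3"
    define c5 where "c5 = exec (JumpPos (tmp_reg 0) l3) c4"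
    have "reaches P 1 c3 c4"
      unfolding c4_def using code(5) c3
      by (intro reaches_exec[where q = "[]" and b = "l2 - 2"]) (auto simp: l2_def)
    moreover have "reaches P 1 c4 c5"
      unfolding c5_def using code(5) c3
      by (intro reaches_exec[where q = "[]" and b = "l2 - 1"]) (auto simp: l2_def c4_def)
    ultimately have "reaches P (time_bound N q + 1 + 1) c2 c5"
      using c3 reaches_trans by blast
    then show ?thesis
    proof (rule simulatesI[OF reaches_mono])
      show "represents c5 (sem (Cond e p q) s)"
        using c3 False by (auto simp: represents_def c4_def c5_def)
      show "same_ctrs d c2 c5"
        using c3 by (auto simp: same_ctrs_def c4_def c5_def)
    qed (auto simp: c4_def c5_def)
  qed
  with reaches_trans[OF c1(1) c2] rep2(2) have
    "simulates P (length (compile_exp e 0) + 1 + (2 + time_bound N p + time_bound N q)) d c l3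
      (sem (Cond e p q) s)"
    by (rule simulates_before)
  then show ?case
    unfolding len by (rule simulates_mono) simp
next
  case (For i x p)
  define body where "body = compile p (Suc d) (b + 9)"
  define lim where "lim = vars s x"
  let ?L = "ctr_reg (2 * d)" and ?K = "ctr_reg (2 * d + 1)"
  define head where "head = [Const (tmp_reg 0) 0, Add ?L (var_reg x) (tmp_reg 0), Const ?K 0]"
  define test where "test = [Sub (tmp_reg 0) ?L ?K, JumpPos (tmp_reg 0) (b + 7)]"
  define exit_code where "exit_code = [Const (tmp_reg 0) 1, JumpPos (tmp_reg 0) (b + 9 + length body + 3)]"
  define enter where "enter = [Const (tmp_reg 0) 0, Add (var_reg i) ?K (tmp_reg 0)]"
  define back_code where "back_code = [Const (tmp_reg 0) 1, Add ?K ?K (tmp_reg 0), JumpPos (tmp_reg 0) (b + 3)]"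
  have code_eq: "compile (For i x p) d b = head @ test @ exit_code @ enter @ body @ back_code"
    by (simp add: head_def test_def exit_code_def enter_def back_code_def body_def)
  have len: "b + length (compile (For i x p) d b) = b + 9 + length body + 3"
    unfolding code_eq by (simp add: head_def test_def exit_code_def enter_def back_code_def)
  have lens: "length head = 3" "length test = 2" "length exit_code = 2" "length enter = 2"
    by (simp_all add: head_def test_def exit_code_def enter_def)
  have code: "code_at P b head" "code_at P (b + 3) test" "code_at P (b + 5) exit_code"
    "code_at P (b + 7) enter" "code_at P (b + 9) body" "code_at P (b + 9 + length body) back_code"
    using For.prems(1) unfolding code_eq code_at_append lens by (simp_all add: ac_simps)
  define it where "it k = fold (\<lambda>k s. sem p (s\<lparr>vars := (vars s)(i := k)\<rparr>)) [0..<k] s" for k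
  \<comment> \<open>Loop invariant at machine level: control is at the test, k iterations are done,
    and both hidden counters have their intended values.\<close>
  define ready where "ready k c' \<longleftrightarrow> pc c' = b + 3 \<and> represents c' (it k) \<and> same_ctrs d c c' \<and>
    reg c' ?L = lim \<and> reg c' ?K = k" for k c'
  have bounded: "lim \<le> N" "k < lim \<Longrightarrow>
      loops_bounded N p ((\<lambda>s. s\<lparr>vars := (vars s)(i := k)\<rparr>) (it k))" for k
    using For.prems by (auto simp: lim_def it_def)
  have two: "reaches P 2 c0 (exec j (exec i c0))"
    if "code_at P l [i, j]" "pc c0 = l" "\<not> is_jump i" for l i j c0
    using reaches_trans[OF reaches_exec[of P l i "[j]" c0] reaches_exec[of P "Suc l" j "[]"]] that
    by (simp add: pc_exec numeral_2_eq_2)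
  have start: "\<exists>c'. reaches P 3 c c' \<and> ready 0 c'"
  proof (intro exI conjI)
    show "reaches P 3 c (fold exec head c)"
      using reaches_fold_exec[OF code(1) For.prems(2)] by (simp add: head_def numeral_3_eq_3)
    show "ready 0 (fold exec head c)"
      using For.prems by (auto simp: ready_def head_def it_def lim_def represents_def same_ctrs_def)
  qed
  have iter: "\<exists>c'. reaches P (time_bound N p + 7) c0 c' \<and> ready (Suc k) c'"
    if c0: "ready k c0" and k: "k < lim" for k c0
  proof -
    define c1 where "c1 = fold exec test c0"
    have r1: "reaches P 2 c0 c1"
      using two[OF code(2)[unfolded test_def]] c0
      by (auto simp: c1_def test_def ready_def simp del: exec.simps)
    have c1: "pc c1 = b + 7" "represents c1 (it k)" "same_ctrs d c c1" "reg c1 ?L = lim" "reg c1 ?K = k"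
      using c0 k by (auto simp: c1_def test_def ready_def represents_def same_ctrs_def)
    define c2 where "c2 = fold exec enter c1"
    have r2: "reaches P 2 c1 c2"
      using two[OF code(4)[unfolded enter_def] c1(1)]
      by (simp add: c2_def enter_def del: exec.simps)
    have c2: "pc c2 = b + 9" "represents c2 ((\<lambda>s. s\<lparr>vars := (vars s)(i := k)\<rparr>) (it k))"
      "same_ctrs d c c2" "reg c2 ?L = lim" "reg c2 ?K = k"
      using c1 by (auto simp: c2_def enter_def represents_def same_ctrs_def)
    have "simulates P (time_bound N p) (Suc d) c2 (b + 9 + length body) (it (Suc k))"
      using For.IH[OF _ c2(1,2) bounded(2)[OF k]] code(5) by (simp add: body_def it_def)
    then obtain c3 where r3: "reaches P (time_bound N p) c2 c3"
      and c3: "pc c3 = b + 9 + length body" "represents c3 (it (Suc k))" "same_ctrs (Suc d) c2 c3"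
      by (auto simp: simulates_def)
    \<comment> \<open>The body is compiled at depth \<open>Suc d\<close>, hence also preserves the
      two counters of this loop.\<close>
    have c3': "same_ctrs d c c3" "reg c3 ?L = lim" "reg c3 ?K = k"
      using c3(3) c2(3,4,5) by (auto simp: same_ctrs_def)
    define c4 where "c4 = fold exec back_code c3"
    have "reaches P 2 c3 (exec (Add ?K ?K (tmp_reg 0)) (exec (Const (tmp_reg 0) 1) c3))"
      using code(6) c3 unfolding back_code_def by (intro two) auto
    moreover have "reaches P 1 (exec (Add ?K ?K (tmp_reg 0)) (exec (Const (tmp_reg 0) 1) c3)) c4"
      using reaches_exec[of P "b + 9 + length body + 2" "JumpPos (tmp_reg 0) (b + 3)" "[]"
          "exec (Add ?K ?K (tmp_reg 0)) (exec (Const (tmp_reg 0) 1) c3)"] code(6) c3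
      by (simp add: c4_def back_code_def)
    ultimately have r4: "reaches P 3 c3 c4"
      using reaches_trans by fastforce
    have "ready (Suc k) c4"
      using c3 c3' by (auto simp: ready_def c4_def back_code_def represents_def same_ctrs_def)
    moreover have "reaches P (time_bound N p + 7) c0 c4"
      using reaches_trans[OF reaches_trans[OF reaches_trans[OF r1 r2] r3] r4]
      by (simp add: add.commute)
    ultimately show ?thesis
      by blast
  qed
  have loop: "k \<le> lim \<Longrightarrow> \<exists>c'. reaches P (3 + k * (time_bound N p + 7)) c c' \<and> ready k c'" for k
  proof (induction k)
    case (Suc k)
    then obtain c' where c': "reaches P (3 + k * (time_bound N p + 7)) c c'" "ready k c'"
      by auto
    obtain c'' where c'': "reaches P (time_bound N p + 7) c' c''" "ready (Suc k) c''"
      using iter[OF c'(2)] Suc.prems by auto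
    have "3 + k * (time_bound N p + 7) + (time_bound N p + 7) = 3 + Suc k * (time_bound N p + 7)"
      by simp
    then show ?case
      using reaches_trans[OF c'(1) c''(1)] c''(2) by metis
  qed (use start in auto)
  then obtain c1 where r1: "reaches P (3 + lim * (time_bound N p + 7)) c c1" and c1: "ready lim c1"
    by blast
  \<comment> \<open>Now both counters equal \<open>lim\<close>, their difference is zero, and the
    test falls through to the exit.\<close>
  define c2 where "c2 = fold exec test c1"
  have r2: "reaches P 2 c1 c2"
    using two[OF code(2)[unfolded test_def]] c1
    by (auto simp: c2_def test_def ready_def simp del: exec.simps)
  have c2: "pc c2 = b + 5" "represents c2 (it lim)" "same_ctrs d c c2"
    using c1 by (auto simp: c2_def test_def ready_def represents_def same_ctrs_def)
  define c3 where "c3 = fold exec exit_code c2"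
  have r3: "reaches P 2 c2 c3"
    using two[OF code(3)[unfolded exit_code_def] c2(1)]
    by (simp add: c3_def exit_code_def del: exec.simps)
  show ?case
    unfolding len
  proof (rule simulatesI[OF reaches_mono[OF reaches_trans[OF reaches_trans[OF r1 r2] r3]]])
    show "3 + lim * (time_bound N p + 7) + 2 + 2 \<le> time_bound N (For i x p)"
      using bounded(1) by simp
    show "represents c3 (sem (For i x p) s)"
      using c2 by (auto simp: c3_def exit_code_def represents_def it_def lim_def)
  qed (use c2 in \<open>auto simp: c3_def exit_code_def same_ctrs_def\<close>)
qed

section \<open>Polynomial time bounds and running times\<close>

text \<open>Adding the exponents instead of taking their maximum yields a common exponent without
  case distinction; the loss is immaterial because any fixed degree will do.\<close>

lemma poly_sum:
  fixes x y K K' N :: nat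
  assumes "x \<le> K * (N + 1) ^ D" "y \<le> K' * (N + 1) ^ D'"
  shows "x + y \<le> (K + K') * (N + 1) ^ (D + D')"
proof -
  have "K * (N + 1) ^ D \<le> K * (N + 1) ^ (D + D')" "K' * (N + 1) ^ D' \<le> K' * (N + 1) ^ (D + D')"
    by (intro mult_left_mono power_increasing; simp)+
  then show ?thesis
    using assms unfolding add_mult_distrib by linarith
qed

text \<open>Each loop raises the degree by one. The order of quantifiers is the point:
  \<open>K\<close> and \<open>D\<close> depend on the command alone, so they stay constant when the
  iteration bound \<open>N\<close> grows with the input.\<close>

lemma time_bound_polynomial: "\<exists>K D. \<forall>N. time_bound N p \<le> K * (N + 1) ^ D"
proof (induction p)
  case (Assign x e)
  show ?case
    by (rule exI[of _ "length (compile_exp e 0) + 2"], rule exI[of _ 0]) simp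
next
  case (Update a e f)
  show ?case
    by (rule exI[of _ "time_bound 0 (Update a e f)"], rule exI[of _ 0]) simp
next
  case (Output e)
  show ?case
    by (rule exI[of _ "length (compile_exp e 0) + 1"], rule exI[of _ 0]) simp
next
  case (Seq p q)
  then obtain K D K' D' where "\<forall>N. time_bound N p \<le> K * (N + 1) ^ D" "\<forall>N. time_bound N q \<le> K' * (N + 1) ^ D'"
    by blast
  then have "time_bound N (p ;; q) \<le> (K + K') * (N + 1) ^ (D + D')" for N
    using poly_sum[of "time_bound N p" K N D "time_bound N q" K' D'] by simp
  then show ?case
    by blast
next
  case (Cond e p q)
  then obtain K D K' D' where "\<forall>N. time_bound N p \<le> K * (N + 1) ^ D" "\<forall>N. time_bound N q \<le> K' * (N + 1) ^ D'"
    by blast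
  then have *: "time_bound N p + time_bound N q \<le> (K + K') * (N + 1) ^ (D + D')" for N
    using poly_sum[of "time_bound N p" K N D "time_bound N q" K' D'] by simp
  have "time_bound N (Cond e p q) \<le> (length (compile_exp e 0) + 3 + (K + K')) * (N + 1) ^ (D + D')" for N
    using poly_sum[OF _ *[of N], of "length (compile_exp e 0) + 3" "length (compile_exp e 0) + 3" 0]
    by simp
  then show ?case
    by blast
next
  case (For i x p)
  then obtain K D where *: "\<forall>N. time_bound N p \<le> K * (N + 1) ^ D"
    by blast
  have "time_bound N (For i x p) \<le> (K + 7) * (N + 1) ^ Suc D" for N
  proof -
    have "time_bound N (For i x p) \<le> (N + 1) * (time_bound N p + 7)"
      by simp
    also have "\<dots> \<le> (N + 1) * (K * (N + 1) ^ D + 7 * (N + 1) ^ D)"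
      using * one_le_power[of "N + 1" D] by (intro mult_left_mono add_mono) auto
    also have "\<dots> = (K + 7) * (N + 1) ^ Suc D"
      by (simp add: algebra_simps)
    finally show ?thesis .
  qed
  then show ?case
    by blast
next
  case (Input x)
  show ?case
    by (rule exI[of _ 1], rule exI[of _ 0]) simp
qed auto

text \<open>A halted configuration is a fixed point of \<open>step\<close>, so any time at which the
  machine has halted shows the same output as the least one.\<close>

lemma halted_running_time:
  assumes "halted P (run P xs t)"
  shows "running_time P xs \<le> t" "result P xs = outp (run P xs t)" "terminates P xs"
proof -
  show "terminates P xs"
    using assms by (auto simp: terminates_def)
  show le: "running_time P xs \<le> t"
    unfolding running_time_def by (rule Least_le) (rule assms)
  have "halted P (run P xs (running_time P xs))"
    unfolding running_time_def by (rule LeastI) (rule assms)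
  then have "run P xs (running_time P xs + k) = run P xs (running_time P xs)" for k
    by (induction k) (auto simp: run_def step_def)
  from this[of "t - running_time P xs"] le show "result P xs = outp (run P xs t)"
    by (simp add: result_def)
qed

definition initial_state :: "nat list \<Rightarrow> ('v, 'a) state" where
  "initial_state xs = \<lparr>vars = (\<lambda>_. 0), arrs = (\<lambda>_ _. 0), ins = xs, outs = []\<rparr>"

text \<open>The compiled code is the whole program, so the address just past its end, where the
  simulation stops, is a halting one.\<close>

lemma compiled_program:
  fixes p :: "('v::countable, 'a::countable) com"
  assumes "loops_bounded N p (initial_state xs)"
  shows "terminates (compile p 0 0) xs" "result (compile p 0 0) xs = outs (sem p (initial_state xs))"
    "running_time (compile p 0 0) xs \<le> time_bound N p"
proof -
  let ?P = "compile p 0 0"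
  let ?c = "\<lparr>pc = 0, reg = (\<lambda>_. 0), inp = xs, outp = []\<rparr>"
  have "represents ?c (initial_state xs :: ('v, 'a) state)"
    by (auto simp: represents_def initial_state_def)
  then have "simulates ?P (time_bound N p) 0 ?c (0 + length (compile p 0 0)) (sem p (initial_state xs))"
    by (intro compile_correct) (auto simp: assms code_at_def)
  then obtain t where t: "t \<le> time_bound N p" "pc (run ?P xs t) = length ?P"
    "outp (run ?P xs t) = outs (sem p (initial_state xs))"
    by (auto simp: simulates_def reaches_def run_def represents_def)
  then have h: "halted ?P (run ?P xs t)"
    by (simp add: halted_def)
  show "terminates ?P xs" "result ?P xs = outs (sem p (initial_state xs))"
    "running_time ?P xs \<le> time_bound N p"
    using halted_running_time[OF h] t by auto
qed

section \<open>Vertex sets as numbers\<close>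

lemma set_encode_less_power: "A \<subseteq> {..<n} \<Longrightarrow> set_encode A < 2 ^ n"
proof -
  assume A: "A \<subseteq> {..<n}"
  then have "set_encode A \<le> (\<Sum>i<n. 2 ^ i)"
    unfolding set_encode_def by (intro sum_mono2) auto
  also have "\<dots> < 2 ^ n"
    by (induction n) auto
  finally show ?thesis .
qed

lemma set_decode_subset_iff: "set_decode S \<subseteq> {..<n} \<longleftrightarrow> S < 2 ^ n"
proof
  show "set_decode S \<subseteq> {..<n} \<Longrightarrow> S < 2 ^ n"
    using set_encode_less_power[of "set_decode S" n] by simp
next
  assume S: "S < 2 ^ n"
  have "i < n" if "i \<in> set_decode S" for i
  proof (rule ccontr)
    assume "\<not> i < n"
    then have "(2::nat) ^ n \<le> 2 ^ i"
      by (intro power_increasing) auto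
    with S have "S < 2 ^ i"
      by linarith
    then have "S div 2 ^ i = 0"
      by simp
    with that show False
      by (simp add: set_decode_def)
  qed
  then show "set_decode S \<subseteq> {..<n}"
    by auto
qed

lemma set_decode_full: "set_decode (2 ^ n - 1) = {..<n}"
proof -
  have "set_encode {..<n} = 2 ^ n - 1"
    unfolding set_encode_def by (induction n) auto
  then show ?thesis
    by (metis finite_lessThan set_encode_inverse)
qed

lemma inj_set_decode: "set_decode S = set_decode T \<longleftrightarrow> S = T"
  by (metis set_decode_inverse)

text \<open>Both sums are binary codes of two-element sets, and the code is injective. This
  justifies the keys of the adjacency table.\<close>

lemma power_sum_eq_iff:
  assumes "u \<noteq> v" "a \<noteq> b"
  shows "(2::nat) ^ u + 2 ^ v = 2 ^ a + 2 ^ b \<longleftrightarrow> {u, v} = {a, b}"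
proof -
  have "set_encode {u, v} = 2 ^ u + 2 ^ v" "set_encode {a, b} = 2 ^ a + 2 ^ b"
    using assms by (simp_all add: set_encode_def)
  then show ?thesis
    by (metis finite.emptyI finite.insertI set_encode_eq)
qed

text \<open>Splitting off the first color change gives a recursion on masks. The forced vertex
  \<open>w\<close> is white, so adding \<open>2 ^ w\<close> produces no carry and inserts exactly
  \<open>w\<close>.\<close>

lemma zero_forcing_mask_iff:
  assumes G: "verts G = {..<n}" and S: "S < 2 ^ n"
  shows "zero_forcing_set G (set_decode S) \<longleftrightarrow> S = 2 ^ n - 1 \<or>
    (\<exists>u<n. u \<in> set_decode S \<and>
      (\<exists>w. {x. x < n \<and> x \<notin> set_decode S \<and> {u, x} \<in> edges G} = {w} \<and>
           zero_forcing_set G (set_decode (S + 2 ^ w))))"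
    (is "_ \<longleftrightarrow> _ \<or> ?R")
proof -
  have sub: "set_decode S \<subseteq> {..<n}"
    using S set_decode_subset_iff by blast
  have full: "set_decode S = {..<n} \<longleftrightarrow> S = 2 ^ n - 1"
    by (metis inj_set_decode set_decode_full)
  have white: "{x \<in> verts G - A. {u, x} \<in> edges G} = {x. x < n \<and> x \<notin> A \<and> {u, x} \<in> edges G}" for u A
    using G by auto
  have ins: "set_decode (S + 2 ^ w) = insert w (set_decode S)" if "w \<notin> set_decode S" for w
    using set_decode_plus_power_2[OF that] by (simp add: add.commute)
  have "zero_forcing_set G (set_decode S) \<longleftrightarrow> S = 2 ^ n - 1 \<or>
      (\<exists>A. color_change G (set_decode S) A \<and> (color_change G)\<^sup>*\<^sup>* A {..<n})"
    unfolding zero_forcing_set_def G full[symmetric] using sub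
    by (metis converse_rtranclpE converse_rtranclp_into_rtranclp rtranclp.rtrancl_refl)
  also have "(\<exists>A. color_change G (set_decode S) A \<and> (color_change G)\<^sup>*\<^sup>* A {..<n}) \<longleftrightarrow> ?R"
  proof
    assume "\<exists>A. color_change G (set_decode S) A \<and> (color_change G)\<^sup>*\<^sup>* A {..<n}"
    then obtain u w where u: "u \<in> set_decode S"
      and w: "{x. x < n \<and> x \<notin> set_decode S \<and> {u, x} \<in> edges G} = {w}"
      and reach: "(color_change G)\<^sup>*\<^sup>* (insert w (set_decode S)) {..<n}"
      unfolding color_change_def white by blast
    from w have "w < n" "w \<notin> set_decode S"
      by auto
    then have "zero_forcing_set G (set_decode (S + 2 ^ w))"
      using reach sub G by (simp add: ins zero_forcing_set_def)
    then show ?R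
      using u w sub by blast
  next
    assume ?R
    then obtain u w where u: "u \<in> set_decode S"
      and w: "{x. x < n \<and> x \<notin> set_decode S \<and> {u, x} \<in> edges G} = {w}"
      and zfs: "zero_forcing_set G (set_decode (S + 2 ^ w))"
      by blast
    from w have "w \<notin> set_decode S"
      by auto
    then have "(color_change G)\<^sup>*\<^sup>* (insert w (set_decode S)) {..<n}"
      using zfs G by (simp add: ins zero_forcing_set_def)
    moreover have "color_change G (set_decode S) (insert w (set_decode S))"
      unfolding color_change_def white using u w by blast
    ultimately show "\<exists>A. color_change G (set_decode S) A \<and> (color_change G)\<^sup>*\<^sup>* A {..<n}"
      by blast
  qed
  finally show ?thesis .
qed

section \<open>A program computing the zero forcing graph\<close>

text \<open>\<open>Order\<close>, \<open>Masks\<close> and \<open>Length\<close> are the only loop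
  bounds. \<open>Length\<close> is first the number of edges read and later the number of edges
  found.\<close>

datatype variable =
    Order | Masks | Length
  | Mask | Mask' | Idx | Idx' | Rest | Vertex | Nbr | Entry | Count | Last | Flag | Size | Least_Size

datatype arr = Power | Adjacent | Forcing | Bit | Bit' | Cardinality | Minimum | Position | Source | Target

instance variable :: countable
  by countable_datatype

instance arr :: countable
  by countable_datatype

type_synonym st = "(variable, arr) state"
type_synonym expr = "(variable, arr) exp"
type_synonym cmd = "(variable, arr) com"

text \<open>Subtraction is truncated, so the sum of the two differences vanishes exactly for equal
  values.\<close>

definition when_eq :: "expr \<Rightarrow> expr \<Rightarrow> cmd \<Rightarrow> cmd" where
  "when_eq e f c = Cond (Plus (Minus e f) (Minus f e)) Skip c"

lemma sem_when_eq [simp]: "sem (when_eq e f c) s = (if eval e s = eval f s then sem c s else s)"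
  by (auto simp: when_eq_def)

lemma when_eq_simps [simp]:
  "written_vars (when_eq e f c) = written_vars c"
  "written_arrs (when_eq e f c) = written_arrs c"
  "silent (when_eq e f c) = silent c"
  "bound_vars (when_eq e f c) = bound_vars c"
  by (simp_all add: when_eq_def)

definition read_order :: cmd where
  "read_order = Input Order ;; Assign Masks (Num 1) ;;
    For Idx Order (Update Power (Var Idx) (Var Masks) ;; Assign Masks (Plus (Var Masks) (Var Masks)))"

definition read_edges :: cmd where
  "read_edges = Input Length ;;
    For Idx Length (Input Vertex ;; Input Nbr ;;
      Update Adjacent (Plus (Elem Power (Var Vertex)) (Elem Power (Var Nbr))) (Num 1))"

text \<open>Greedy extraction from the highest power down. The loop variable counts upwards, hence
  the exponent \<open>Order - (Idx' + 1)\<close>; the added 1 in the condition turns the strict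
  comparison into \<open>Rest >= 2 ^ Entry\<close>. Zeros are written as well because the array
  still holds the digits of an earlier mask.\<close>

definition bits :: "arr \<Rightarrow> variable \<Rightarrow> cmd" where
  "bits a x = Assign Rest (Var x) ;;
    For Idx' Order (Assign Entry (Minus (Var Order) (Plus (Var Idx') (Num 1))) ;;
      Cond (Minus (Plus (Var Rest) (Num 1)) (Elem Power (Var Entry)))
        (Update a (Var Entry) (Num 1) ;; Assign Rest (Minus (Var Rest) (Elem Power (Var Entry))))
        (Update a (Var Entry) (Num 0)))"

text \<open>Remembering the last white neighbor is enough: if the count is one, it is the unique
  one.\<close>

definition white_neighbors :: cmd where
  "white_neighbors = Assign Count (Num 0) ;;
    For Nbr Order (Cond (Elem Bit (Var Nbr)) Skip
      (Cond (Elem Adjacent (Plus (Elem Power (Var Vertex)) (Elem Power (Var Nbr))))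
        (Assign Count (Plus (Var Count) (Num 1)) ;; Assign Last (Var Nbr)) Skip))"

text \<open>A forcing step increases the number of a set, so the numbers are treated in decreasing order.\<close>

definition find_forcing :: cmd where
  "find_forcing = For Idx Masks (
    Assign Mask (Minus (Var Masks) (Plus (Var Idx) (Num 1))) ;;
    bits Bit Mask ;;
    Assign Flag (Num 0) ;; Cond (Var Idx) Skip (Assign Flag (Num 1)) ;;
    For Vertex Order (Cond (Elem Bit (Var Vertex))
      (white_neighbors ;;
       when_eq (Var Count) (Num 1)
         (Cond (Elem Forcing (Plus (Var Mask) (Elem Power (Var Last)))) (Assign Flag (Num 1)) Skip))
      Skip) ;;
    Update Forcing (Var Mask) (Var Flag))"

text \<open>\<open>Order\<close> is a safe initial minimum, as the full vertex set is zero
  forcing.\<close>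

definition find_sizes :: cmd where
  "find_sizes = Assign Least_Size (Var Order) ;;
    For Mask Masks (bits Bit Mask ;; Assign Size (Num 0) ;;
      For Idx Order (Assign Size (Plus (Var Size) (Elem Bit (Var Idx)))) ;;
      Update Cardinality (Var Mask) (Var Size) ;;
      Cond (Elem Forcing (Var Mask))
        (Cond (Minus (Var Least_Size) (Var Size)) (Assign Least_Size (Var Size)) Skip) Skip)"

definition find_positions :: cmd where
  "find_positions = Assign Count (Num 0) ;;
    For Mask Masks (Update Minimum (Var Mask) (Num 0) ;;
      Cond (Elem Forcing (Var Mask))
        (when_eq (Elem Cardinality (Var Mask)) (Var Least_Size)
          (Update Minimum (Var Mask) (Num 1) ;; Update Position (Var Mask) (Var Count) ;;
           Assign Count (Plus (Var Count) (Num 1))))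
        Skip)"

definition print_vertices :: cmd where
  "print_vertices = Output (Var Count) ;;
    For Mask Masks (Cond (Elem Minimum (Var Mask))
      (Output (Elem Cardinality (Var Mask)) ;; bits Bit Mask ;;
       For Idx Order (Cond (Elem Bit (Var Idx)) (Output (Var Idx)) Skip)) Skip)"

text \<open>Requiring \<open>Mask < Mask'\<close> lists each edge in one orientation only. For
  digits, the sum of the two truncated differences is exclusive or, so the loop counts the symmetric
  difference. The pairs are buffered in arrays because the output format demands the number of edges
  before the edges themselves.\<close>

definition test_edge :: cmd where
  "test_edge = Cond (Elem Minimum (Var Mask)) (Cond (Elem Minimum (Var Mask')) (
    Cond (Minus (Var Mask') (Var Mask)) (
      bits Bit Mask ;; bits Bit' Mask' ;; Assign Size (Num 0) ;;
      For Idx Order (Assign Size (Plus (Var Size)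
        (Plus (Minus (Elem Bit (Var Idx)) (Elem Bit' (Var Idx)))
              (Minus (Elem Bit' (Var Idx)) (Elem Bit (Var Idx)))))) ;;
      when_eq (Var Size) (Num 2) (
        Update Source (Var Length) (Elem Position (Var Mask)) ;;
        Update Target (Var Length) (Elem Position (Var Mask')) ;;
        Assign Length (Plus (Var Length) (Num 1)))) Skip) Skip) Skip"

definition find_edges :: cmd where
  "find_edges = Assign Length (Num 0) ;; For Mask Masks (For Mask' Masks test_edge)"

definition print_edges :: cmd where
  "print_edges = Output (Var Length) ;;
    For Idx Length (Output (Elem Source (Var Idx)) ;; Output (Elem Target (Var Idx)))"

text \<open>The grouping follows the loop bounds: the middle block loops over \<open>Order\<close>
  and \<open>Masks\<close> only and assigns neither, so its iterations are bounded by a single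
  inspection of the state in which it starts.\<close>

definition zero_forcing_program :: cmd where
  "zero_forcing_program = (read_order ;; read_edges) ;;
    (find_forcing ;; find_sizes ;; find_positions ;; print_vertices ;; find_edges) ;; print_edges"

lemma written_vars_simps [simp]:
  "written_vars (bits a x) = {Rest, Idx', Entry}"
  "written_vars white_neighbors = {Count, Nbr, Last}"
  "written_vars find_forcing = {Idx, Mask, Rest, Idx', Entry, Flag, Vertex, Count, Nbr, Last}"
  "written_vars find_sizes = {Least_Size, Mask, Rest, Idx', Entry, Size, Idx}"
  "written_vars find_positions = {Count, Mask}"
  "written_vars print_vertices = {Mask, Rest, Idx', Entry, Idx}"
  "written_vars test_edge = {Rest, Idx', Entry, Size, Idx, Length}"
  "written_vars find_edges = {Length, Mask, Mask', Rest, Idx', Entry, Size, Idx}"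
  by (auto simp: bits_def white_neighbors_def find_forcing_def find_sizes_def find_positions_def
      print_vertices_def test_edge_def find_edges_def)

lemma written_arrs_simps [simp]:
  "written_arrs (bits a x) = {a}"
  "written_arrs white_neighbors = {}"
  "written_arrs find_forcing = {Bit, Forcing}"
  "written_arrs find_sizes = {Bit, Cardinality}"
  "written_arrs find_positions = {Minimum, Position}"
  "written_arrs print_vertices = {Bit}"
  "written_arrs test_edge = {Bit, Bit', Source, Target}"
  "written_arrs find_edges = {Bit, Bit', Source, Target}"
  by (auto simp: bits_def white_neighbors_def find_forcing_def find_sizes_def find_positions_def
      print_vertices_def test_edge_def find_edges_def)

lemma silent_simps [simp]:
  "silent read_order" "silent read_edges" "silent (bits a x)" "silent white_neighbors"
  "silent find_forcing" "silent find_sizes" "silent find_positions" "silent test_edge"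
  "silent find_edges"
  by (auto simp: read_order_def read_edges_def bits_def white_neighbors_def find_forcing_def
      find_sizes_def find_positions_def test_edge_def find_edges_def)

section \<open>Binary digits, stored graphs and white neighbors\<close>

lemma bits_correct:
  assumes n: "vars s Order = n" and pow: "\<forall>i<n. arrs s Power i = 2 ^ i"
    and S: "vars s x < 2 ^ n" and a: "a \<noteq> Power"
  shows "\<forall>i<n. arrs (sem (bits a x) s) a i = of_bool (i \<in> set_decode (vars s x))"
proof -
  define S where "S = vars s x"
  define s0 where "s0 = s\<lparr>vars := (vars s)(Rest := S)\<rparr>"
  define body where "body = Assign Entry (Minus (Var Order) (Plus (Var Idx') (Num 1))) ;;
      Cond (Minus (Plus (Var Rest) (Num 1)) (Elem Power (Var Entry)))
        (Update a (Var Entry) (Num 1) ;; Assign Rest (Minus (Var Rest) (Elem Power (Var Entry))))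
        (Update a (Var Entry) (Num 0))"
  \<comment> \<open>\<open>Rest\<close> keeps the digits not yet split off; initially this is the
    whole mask, since it is below \<open>2 ^ n\<close>.\<close>
  define I where "I k s' \<longleftrightarrow> vars s' Order = n \<and> (\<forall>i<n. arrs s' Power i = 2 ^ i) \<and>
      vars s' Rest = S mod 2 ^ (n - k) \<and> (\<forall>i<n. n - k \<le> i \<longrightarrow> arrs s' a i = of_bool (i \<in> set_decode S))"
    for k and s' :: st
  have "I (vars s0 Order) (sem (For Idx' Order body) s0)"
  proof (rule sem_For_induct)
    show "I 0 s0"
      using assms by (auto simp: I_def s0_def S_def)
  next
    fix k s' assume k: "k < vars s0 Order" and I: "I k s'"
    define i where "i = n - Suc k"
    have i: "i < n" "n - k = Suc i" "n - Suc k = i"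
      using k n by (auto simp: i_def s0_def)
    define r where "r = S mod 2 ^ Suc i"
    define r' where "r' = S mod 2 ^ i"
    have "S div 2 ^ i mod 2 = of_bool (i \<in> set_decode S)"
      by (simp add: set_decode_def mod_2_eq_odd)
    \<comment> \<open>Digit i contributes \<open>2 ^ i\<close> to the remainder modulo
      \<open>2 ^ Suc i\<close>, and the lower digits together stay below \<open>2 ^ i\<close>; so
      comparing the remainder with \<open>2 ^ i\<close> reads off the digit.\<close>
    then have r: "r = (if i \<in> set_decode S then 2 ^ i + r' else r')"
      using mod_mult2_eq[of S "2 ^ i" 2] unfolding r_def r'_def by (simp add: mult.commute)
    have "r' < 2 ^ i"
      by (simp add: r'_def)
    then have rest: "i \<in> set_decode S \<longleftrightarrow> 2 ^ i < Suc r"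
      "S mod 2 ^ i = (if i \<in> set_decode S then r - 2 ^ i else r)"
      unfolding r r'_def[symmetric] by simp_all
    have I': "vars s' Order = n" "\<forall>i<n. arrs s' Power i = 2 ^ i" "vars s' Rest = r"
      "\<forall>j<n. Suc i \<le> j \<longrightarrow> arrs s' a j = of_bool (j \<in> set_decode S)"
      using I i by (auto simp: I_def r_def)
    define s1 where "s1 = sem body (s'\<lparr>vars := (vars s')(Idx' := k)\<rparr>)"
    have s1: "vars s1 Order = n" "arrs s1 Power = arrs s' Power"
      "vars s1 Rest = (if 2 ^ i < Suc r then r - 2 ^ i else r)"
      "arrs s1 a = (arrs s' a)(i := of_bool (2 ^ i < Suc r))"
      using I' i a by (auto simp: s1_def body_def)
    have "arrs s1 a j = of_bool (j \<in> set_decode S)" if "j < n" "i \<le> j" for j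
      using that I'(4) rest(1) unfolding s1(4) by (cases "j = i") auto
    then show "I (Suc k) s1"
      unfolding I_def i(3) s1(2) using s1 I'(2) rest by auto
  qed
  then have "I n (sem (bits a x) s)"
    unfolding n[symmetric]
    by (simp add: bits_def body_def s0_def S_def n del: sem.simps(8))
  then show ?thesis
    by (simp add: I_def S_def)
qed

text \<open>Keys with \<open>u = w\<close> are left unspecified. They are never looked up: neighbors
  are sought for a blue vertex and only among white ones.\<close>

definition graph_stored :: "nat graph \<Rightarrow> nat \<Rightarrow> st \<Rightarrow> bool" where
  "graph_stored G n s \<longleftrightarrow> vars s Order = n \<and> vars s Masks = 2 ^ n \<and>
     (\<forall>i<n. arrs s Power i = 2 ^ i) \<and>
     (\<forall>u<n. \<forall>w<n. u \<noteq> w \<longrightarrow> arrs s Adjacent (2 ^ u + 2 ^ w) = of_bool ({u, w} \<in> edges G))"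

lemma graph_stored_vars [simp]:
  "f Order = vars s Order \<Longrightarrow> f Masks = vars s Masks \<Longrightarrow>
   graph_stored G n (s\<lparr>vars := f\<rparr>) = graph_stored G n s"
  by (auto simp: graph_stored_def)

lemma graph_stored_arrs [simp]:
  "f Power = arrs s Power \<Longrightarrow> f Adjacent = arrs s Adjacent \<Longrightarrow>
   graph_stored G n (s\<lparr>arrs := f\<rparr>) = graph_stored G n s"
  by (auto simp: graph_stored_def)

lemma graph_stored_outs [simp]: "graph_stored G n (s\<lparr>outs := os\<rparr>) = graph_stored G n s"
  by (auto simp: graph_stored_def)

lemma graph_stored_sem:
  "Order \<notin> written_vars c \<Longrightarrow> Masks \<notin> written_vars c \<Longrightarrow> Power \<notin> written_arrs c \<Longrightarrow>
   Adjacent \<notin> written_arrs c \<Longrightarrow> graph_stored G n (sem c s) = graph_stored G n s"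
  by (simp add: graph_stored_def vars_sem arrs_sem)

lemma bits_stored:
  assumes "graph_stored G n s" "vars s x < 2 ^ n" "a \<noteq> Power" "i < n"
  shows "arrs (sem (bits a x) s) a i = of_bool (i \<in> set_decode (vars s x))"
  using bits_correct[of s n x a] assms by (auto simp: graph_stored_def)

lemma white_neighbors_correct:
  assumes stored: "graph_stored G n s" and u: "vars s Vertex = u" "u < n" "u \<in> A"
    and bit: "\<forall>i<n. arrs s Bit i = of_bool (i \<in> A)"
  defines "W \<equiv> {x. x < n \<and> x \<notin> A \<and> {u, x} \<in> edges G}"
  shows "vars (sem white_neighbors s) Count = card W \<and>
    (W \<noteq> {} \<longrightarrow> vars (sem white_neighbors s) Last \<in> W)"
proof -
  define Wk where "Wk k = {x. x < k \<and> x \<notin> A \<and> {u, x} \<in> edges G}" for k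
  have Suc: "Wk (Suc k) = (if k \<notin> A \<and> {u, k} \<in> edges G then insert k (Wk k) else Wk k)"
    and fin: "finite (Wk k)" "k \<notin> Wk k" for k
    by (auto simp: Wk_def less_Suc_eq)
  define I where "I k s' \<longleftrightarrow> graph_stored G n s' \<and> vars s' Vertex = u \<and>
      (\<forall>i<n. arrs s' Bit i = of_bool (i \<in> A)) \<and> vars s' Count = card (Wk k) \<and>
      (Wk k \<noteq> {} \<longrightarrow> vars s' Last \<in> Wk k)" for k and s' :: st
  define s0 where "s0 = s\<lparr>vars := (vars s)(Count := 0)\<rparr>"
  define body where "body = Cond (Elem Bit (Var Nbr)) Skip
      (Cond (Elem Adjacent (Plus (Elem Power (Var Vertex)) (Elem Power (Var Nbr))))
        (Assign Count (Plus (Var Count) (Num 1)) ;; Assign Last (Var Nbr)) (Skip :: cmd))"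
  have n: "vars s0 Order = n"
    using stored by (simp add: s0_def graph_stored_def)
  have "I (vars s0 Order) (sem (For Nbr Order body) s0)"
  proof (rule sem_For_induct)
    show "I 0 s0"
      using stored u bit by (simp add: I_def s0_def Wk_def)
  next
    fix k s' assume k: "k < vars s0 Order" and I: "I k s'"
    have bitk: "arrs s' Bit k = of_bool (k \<in> A)"
      using I k n by (simp add: I_def)
    have adjk: "arrs s' Adjacent (arrs s' Power u + arrs s' Power k) = of_bool ({u, k} \<in> edges G)"
      if "k \<notin> A"
    proof -
      have "u \<noteq> k"
        using that u by auto
      then show ?thesis
        using I k n u by (auto simp: I_def graph_stored_def)
    qed
    show "I (Suc k) (sem body (s'\<lparr>vars := (vars s')(Nbr := k)\<rparr>))"
      using I bitk adjk fin[of k] by (auto simp: I_def body_def Suc)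
  qed
  then have "I n (sem white_neighbors s)"
    unfolding n by (simp add: white_neighbors_def body_def s0_def del: sem.simps(8))
  then show ?thesis
    by (simp add: I_def Wk_def W_def)
qed

section \<open>The table of zero forcing sets\<close>

text \<open>The outer invariant \<open>I\<close> asserts the table for the k largest masks, the
  inner invariant \<open>J\<close> describes the flag after the vertices below j have been tried as
  forcing vertices. The table stays fixed during the inner loop, so its lookups can rely on
  \<open>I\<close>.\<close>

lemma find_forcing_correct:
  assumes stored: "graph_stored G n s" and G: "verts G = {..<n}"
  shows "\<forall>S<2 ^ n. arrs (sem find_forcing s) Forcing S = of_bool (zero_forcing_set G (set_decode S))"
proof -
  let ?Z = "\<lambda>S. zero_forcing_set G (set_decode S)"
  define search where "search = Cond (Elem Bit (Var Vertex))
      (white_neighbors ;;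
       when_eq (Var Count) (Num 1)
         (Cond (Elem Forcing (Plus (Var Mask) (Elem Power (Var Last)))) (Assign Flag (Num 1)) Skip))
      Skip"
  define body where "body = Assign Mask (Minus (Var Masks) (Plus (Var Idx) (Num 1))) ;;
    bits Bit Mask ;; Assign Flag (Num 0) ;; Cond (Var Idx) Skip (Assign Flag (Num 1)) ;;
    For Vertex Order search ;; Update Forcing (Var Mask) (Var Flag)"
  define I where "I k s' \<longleftrightarrow> graph_stored G n s' \<and>
      (\<forall>S<2 ^ n. 2 ^ n - k \<le> S \<longrightarrow> arrs s' Forcing S = of_bool (?Z S))" for k and s' :: st
  have masks: "vars s Masks = 2 ^ n"
    using stored by (simp add: graph_stored_def)
  have "I (vars s Masks) (sem (For Idx Masks body) s)"
  proof (rule sem_For_induct)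
    show "I 0 s"
      using stored by (simp add: I_def)
  next
    fix k s' assume k: "k < vars s Masks" and I: "I k s'"
    define S where "S = 2 ^ n - Suc k"
    have S: "S < 2 ^ n" "2 ^ n - k = Suc S"
      using k masks by (auto simp: S_def)
    \<comment> \<open>The first iteration treats the full vertex set, the base case of the
      recursion, for which the flag is preset to 1.\<close>
    have full: "S = 2 ^ n - 1 \<longleftrightarrow> k = 0"
      using k masks by (auto simp: S_def)
    let ?A = "set_decode S"
    define s1 where "s1 = sem (bits Bit Mask) (s'\<lparr>vars := (vars s')(Idx := k, Mask := S)\<rparr>)"
    have s1: "graph_stored G n s1" "vars s1 Mask = S" "vars s1 Idx = k"
      "\<forall>i<n. arrs s1 Bit i = of_bool (i \<in> ?A)" "arrs s1 Forcing = arrs s' Forcing"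
      using I S bits_stored[of G n "s'\<lparr>vars := (vars s')(Idx := k, Mask := S)\<rparr>" Mask Bit]
      by (auto simp: s1_def I_def graph_stored_sem vars_sem arrs_sem)
    define s2 where "s2 = s1\<lparr>vars := (vars s1)(Flag := of_bool (k = 0))\<rparr>"
    define forces where "forces u \<longleftrightarrow> u \<in> ?A \<and>
        (\<exists>w. {x. x < n \<and> x \<notin> ?A \<and> {u, x} \<in> edges G} = {w} \<and> ?Z (S + 2 ^ w))" for u
    define J where "J j t \<longleftrightarrow> graph_stored G n t \<and> vars t Mask = S \<and>
        (\<forall>i<n. arrs t Bit i = of_bool (i \<in> ?A)) \<and> arrs t Forcing = arrs s' Forcing \<and>
        vars t Flag = of_bool (k = 0 \<or> (\<exists>u<j. forces u))" for j and t :: st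
    have n: "vars s2 Order = n"
      using s1 by (simp add: s2_def graph_stored_def)
    have "J (vars s2 Order) (sem (For Vertex Order search) s2)"
    proof (rule sem_For_induct)
      show "J 0 s2"
        using s1 by (simp add: J_def s2_def)
    next
      fix u t assume u: "u < vars s2 Order" and J: "J u t"
      let ?t = "t\<lparr>vars := (vars t)(Vertex := u)\<rparr>"
      have un: "u < n"
        using u n by simp
      show "J (Suc u) (sem search ?t)"
      proof (cases "u \<in> ?A")
        case False
        then have "sem search ?t = ?t"
          using J un by (simp add: search_def J_def)
        with False J show ?thesis
          by (auto simp: J_def forces_def less_Suc_eq)
      next
        case uA: True
        define W where "W = {x. x < n \<and> x \<notin> ?A \<and> {u, x} \<in> edges G}"
        define t' where "t' = sem white_neighbors ?t"
        have t': "graph_stored G n t'" "vars t' Mask = S" "arrs t' Bit = arrs t Bit"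
          "arrs t' Forcing = arrs s' Forcing" "vars t' Flag = vars t Flag"
          using J by (auto simp: t'_def J_def graph_stored_sem vars_sem arrs_sem)
        have W: "vars t' Count = card W" "W \<noteq> {} \<longrightarrow> vars t' Last \<in> W"
          using white_neighbors_correct[of G n ?t u ?A] J uA un by (auto simp: J_def t'_def W_def)
        have step: "sem search ?t = (if card W = 1 \<and> 0 < arrs t' Forcing (S + arrs t' Power (vars t' Last))
            then t'\<lparr>vars := (vars t')(Flag := 1)\<rparr> else t')"
          using J uA un W t' by (simp add: search_def J_def t'_def[symmetric])
        have "forces u \<longleftrightarrow> card W = 1 \<and> 0 < arrs t' Forcing (S + arrs t' Power (vars t' Last))"
        proof (cases "card W = 1")
          case False
          then show ?thesis
            by (auto simp: forces_def W_def[symmetric])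
        next
          case True
          then obtain w where w: "W = {w}"
            by (auto simp: card_1_singleton_iff)
          then have wn: "w < n" "w \<notin> ?A"
            by (auto simp: W_def)
          have "vars t' Last = w" "arrs t' Power w = 2 ^ w"
            using W(2) w t'(1) wn by (auto simp: graph_stored_def)
          \<comment> \<open>The mask looked up codes a subset of the vertices and exceeds
            \<open>S\<close>, so its entry is already filled in.\<close>
          moreover have "arrs t' Forcing (S + 2 ^ w) = of_bool (?Z (S + 2 ^ w))"
          proof -
            have "set_decode (S + 2 ^ w) = insert w ?A"
              using set_decode_plus_power_2[OF wn(2)] by (simp add: add.commute)
            then have "set_decode (S + 2 ^ w) \<subseteq> {..<n}"
              using set_decode_subset_iff[of S n] S wn by auto
            then have "S + 2 ^ w < 2 ^ n"
              using set_decode_subset_iff by blast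
            moreover have "Suc S \<le> S + 2 ^ w"
              by simp
            ultimately show ?thesis
              using I S t'(4) unfolding I_def by metis
          qed
          ultimately show ?thesis
            using uA w by (auto simp: forces_def W_def[symmetric])
        qed
        with step t' J show ?thesis
          by (auto simp: J_def less_Suc_eq)
      qed
    qed
    then have J: "J n (sem (For Vertex Order search) s2)"
      by (simp only: n)
    define s3 where "s3 = sem (For Vertex Order search) s2"
    have "?Z S \<longleftrightarrow> k = 0 \<or> (\<exists>u<n. forces u)"
      unfolding forces_def using zero_forcing_mask_iff[OF G S(1)] full by blast
    then have s3: "graph_stored G n s3" "vars s3 Mask = S" "arrs s3 Forcing = arrs s' Forcing"
      "vars s3 Flag = of_bool (?Z S)"
      using J by (auto simp: J_def s3_def)
    have "sem body (s'\<lparr>vars := (vars s')(Idx := k)\<rparr>) =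
        s3\<lparr>arrs := (arrs s3)(Forcing := (arrs s3 Forcing)(S := of_bool (?Z S)))\<rparr>"
    proof -
      have mask: "sem (Assign Mask (Minus (Var Masks) (Plus (Var Idx) (Num 1)))) (s'\<lparr>vars := (vars s')(Idx := k)\<rparr>) =
          s'\<lparr>vars := (vars s')(Idx := k, Mask := S)\<rparr>"
        using I by (simp add: I_def graph_stored_def S_def)
      have flag: "sem (Cond (Var Idx) Skip (Assign Flag (Num 1))) (sem (Assign Flag (Num 0)) s1) = s2"
        using s1(3) by (simp add: s2_def)
      have "sem body (s'\<lparr>vars := (vars s')(Idx := k)\<rparr>) = sem (Update Forcing (Var Mask) (Var Flag)) s3"
        by (simp only: body_def sem.simps(6) mask flag s1_def[symmetric] s3_def[symmetric])
      then show ?thesis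
        using s3 by simp
    qed
    then show "I (Suc k) (sem body (s'\<lparr>vars := (vars s')(Idx := k)\<rparr>))"
      using s3 I S by (auto simp: I_def S_def[symmetric])
  qed
  then have "I (2 ^ n) (sem find_forcing s)"
    by (simp add: find_forcing_def body_def search_def masks del: sem.simps(8))
  then show ?thesis
    by (simp add: I_def)
qed

section \<open>Cardinalities, the zero forcing number and the list of minimum sets\<close>

text \<open>Serves both for cardinalities of sets and for symmetric differences. The hypothesis on
  \<open>e\<close> lets the summand read the arrays and the index, but not the accumulator.\<close>

lemma sem_sum_loop:
  fixes s :: st
  assumes "vars s Order = n" "vars s Size = 0"
    and e: "\<And>t. arrs t = arrs s \<Longrightarrow> vars t Idx < n \<Longrightarrow> eval e t = f (vars t Idx)"
  shows "vars (sem (For Idx Order (Assign Size (Plus (Var Size) e))) s) Size = (\<Sum>i<n. f i)"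
proof -
  let ?c = "Assign Size (Plus (Var Size) e)"
  define I where "I k t \<longleftrightarrow> arrs t = arrs s \<and> vars t Size = (\<Sum>i<k. f i)" for k and t :: st
  have "I (vars s Order) (sem (For Idx Order ?c) s)"
    by (rule sem_For_induct) (use assms in \<open>auto simp: I_def\<close>)
  then show ?thesis
    using assms(1) by (simp add: I_def)
qed

text \<open>The invariant records both halves of minimality: \<open>Least_Size\<close> is at most
  the size of every zero forcing set seen so far, and it is always attained by some zero forcing
  set.\<close>

lemma find_sizes_correct:
  assumes stored: "graph_stored G n s" and G: "verts G = {..<n}"
    and forcing: "\<forall>S<2 ^ n. arrs s Forcing S = of_bool (zero_forcing_set G (set_decode S))"
  shows "(\<forall>S<2 ^ n. arrs (sem find_sizes s) Cardinality S = card (set_decode S)) \<and>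
    vars (sem find_sizes s) Least_Size = zero_forcing_number G"
proof -
  let ?Z = "\<lambda>S. zero_forcing_set G (set_decode S)"
  define count where "count = For Idx Order (Assign Size (Plus (Var Size) (Elem Bit (Var Idx) :: expr)))"
  define body where "body = bits Bit Mask ;; Assign Size (Num 0) ;; count ;;
      Update Cardinality (Var Mask) (Var Size) ;;
      Cond (Elem Forcing (Var Mask))
        (Cond (Minus (Var Least_Size) (Var Size)) (Assign Least_Size (Var Size)) Skip) Skip"
  define I where "I k s' \<longleftrightarrow> graph_stored G n s' \<and> arrs s' Forcing = arrs s Forcing \<and>
      (\<forall>S<k. arrs s' Cardinality S = card (set_decode S)) \<and>
      (\<forall>S<k. ?Z S \<longrightarrow> vars s' Least_Size \<le> card (set_decode S)) \<and>
      (\<exists>B. zero_forcing_set G B \<and> card B = vars s' Least_Size)" for k and s' :: st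
  define s0 where "s0 = s\<lparr>vars := (vars s)(Least_Size := vars s Order)\<rparr>"
  have masks: "vars s0 Masks = 2 ^ n"
    using stored by (simp add: graph_stored_def s0_def)
  have "I (vars s0 Masks) (sem (For Mask Masks body) s0)"
  proof (rule sem_For_induct)
    have "zero_forcing_set G {..<n}"
      using G by (simp add: zero_forcing_set_def)
    then show "I 0 s0"
      using stored by (auto simp: I_def s0_def graph_stored_def intro!: exI[of _ "{..<n}"])
  next
    fix S s' assume S: "S < vars s0 Masks" and I: "I S s'"
    have S': "S < 2 ^ n"
      using S masks by simp
    then have sub: "set_decode S \<subseteq> {..<n}"
      using set_decode_subset_iff by blast
    define s1 where "s1 = sem (bits Bit Mask) (s'\<lparr>vars := (vars s')(Mask := S)\<rparr>)"
    have s1: "graph_stored G n s1" "vars s1 Mask = S" "vars s1 Least_Size = vars s' Least_Size"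
      "arrs s1 Forcing = arrs s Forcing" "arrs s1 Cardinality = arrs s' Cardinality"
      "\<forall>i<n. arrs s1 Bit i = of_bool (i \<in> set_decode S)"
      using I S' bits_stored[of G n "s'\<lparr>vars := (vars s')(Mask := S)\<rparr>" Mask Bit]
      by (auto simp: s1_def I_def graph_stored_sem vars_sem arrs_sem)
    define s2 where "s2 = sem count (s1\<lparr>vars := (vars s1)(Size := 0)\<rparr>)"
    have "vars s2 Size = (\<Sum>i<n. of_bool (i \<in> set_decode S))"
      unfolding s2_def count_def using s1
      by (intro sem_sum_loop) (auto simp: graph_stored_def)
    also have "\<dots> = card (set_decode S)"
      using sub by (simp add: sum_of_bool_eq Int_absorb1)
    finally have s2: "vars s2 Size = card (set_decode S)" "graph_stored G n s2" "vars s2 Mask = S"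
      "vars s2 Least_Size = vars s' Least_Size"
      "arrs s2 Forcing = arrs s Forcing" "arrs s2 Cardinality = arrs s' Cardinality"
      using s1 by (auto simp: s2_def count_def graph_stored_sem vars_sem arrs_sem simp del: sem.simps)
    have "sem body (s'\<lparr>vars := (vars s')(Mask := S)\<rparr>) = sem (Update Cardinality (Var Mask) (Var Size) ;;
      Cond (Elem Forcing (Var Mask))
        (Cond (Minus (Var Least_Size) (Var Size)) (Assign Least_Size (Var Size)) Skip) Skip) s2"
      by (simp add: body_def s1_def s2_def)
    then show "I (Suc S) (sem body (s'\<lparr>vars := (vars s')(Mask := S)\<rparr>))"
      using I s2 forcing S' by (force simp: I_def less_Suc_eq)
  qed
  then have I: "I (2 ^ n) (sem find_sizes s)"
    by (simp add: find_sizes_def body_def count_def s0_def[symmetric] masks del: sem.simps(8))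
  have "zero_forcing_number G = vars (sem find_sizes s) Least_Size"
    unfolding zero_forcing_number_def
  proof (rule Least_equality)
    fix m assume "\<exists>B. zero_forcing_set G B \<and> card B = m"
    then obtain B where B: "zero_forcing_set G B" "card B = m"
      by blast
    then have "B \<subseteq> {..<n}"
      using G by (simp add: zero_forcing_set_def)
    then have "set_encode B < 2 ^ n" "set_decode (set_encode B) = B"
      using set_encode_less_power finite_subset by (blast, simp add: finite_subset)
    with I B show "vars (sem find_sizes s) Least_Size \<le> m"
      by (metis I_def)
  qed (use I in \<open>simp add: I_def\<close>)
  with I show ?thesis
    by (simp add: I_def)
qed

abbreviation minimum_mask :: "nat graph \<Rightarrow> nat \<Rightarrow> bool" where
  "minimum_mask G S \<equiv> minimum_zero_forcing_set G (set_decode S)"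

text \<open>For a minimum mask this is its index in the increasing list of minimum masks. For
  arbitrary \<open>S\<close> it is the value of the running counter when \<open>S\<close> is
  reached, so one function describes both the counter and the stored indices.\<close>

definition position :: "nat graph \<Rightarrow> nat \<Rightarrow> nat" where
  "position G S = length (filter (minimum_mask G) [0..<S])"

definition minimum_stored :: "nat graph \<Rightarrow> nat \<Rightarrow> st \<Rightarrow> bool" where
  "minimum_stored G n s \<longleftrightarrow> graph_stored G n s \<and>
     (\<forall>S<2 ^ n. arrs s Cardinality S = card (set_decode S) \<and>
        arrs s Minimum S = of_bool (minimum_mask G S) \<and>
        (minimum_mask G S \<longrightarrow> arrs s Position S = position G S))"

lemma find_positions_correct:
  assumes stored: "graph_stored G n s"
    and forcing: "\<forall>S<2 ^ n. arrs s Forcing S = of_bool (zero_forcing_set G (set_decode S))"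
    and size: "\<forall>S<2 ^ n. arrs s Cardinality S = card (set_decode S)"
    and least: "vars s Least_Size = zero_forcing_number G"
  shows "minimum_stored G n (sem find_positions s)"
    and "vars (sem find_positions s) Count = length (filter (minimum_mask G) [0..<2 ^ n])"
proof -
  define body where "body = Update Minimum (Var Mask) (Num 0) ;;
      Cond (Elem Forcing (Var Mask))
        (when_eq (Elem Cardinality (Var Mask)) (Var Least_Size)
          (Update Minimum (Var Mask) (Num 1) ;; Update Position (Var Mask) (Var Count) ;;
           Assign Count (Plus (Var Count) (Num 1))))
        Skip"
  define I where "I k s' \<longleftrightarrow> graph_stored G n s' \<and> arrs s' Forcing = arrs s Forcing \<and>
      arrs s' Cardinality = arrs s Cardinality \<and> vars s' Least_Size = zero_forcing_number G \<and>
      vars s' Count = position G k \<and>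
      (\<forall>S<k. arrs s' Minimum S = of_bool (minimum_mask G S) \<and>
        (minimum_mask G S \<longrightarrow> arrs s' Position S = position G S))" for k and s' :: st
  define s0 where "s0 = s\<lparr>vars := (vars s)(Count := 0)\<rparr>"
  have masks: "vars s0 Masks = 2 ^ n"
    using stored by (simp add: graph_stored_def s0_def)
  have "I (vars s0 Masks) (sem (For Mask Masks body) s0)"
  proof (rule sem_For_induct)
    show "I 0 s0"
      using stored least by (simp add: I_def s0_def position_def)
  next
    fix S s' assume S: "S < vars s0 Masks" and I: "I S s'"
    have S': "S < 2 ^ n"
      using S masks by simp
    show "I (Suc S) (sem body (s'\<lparr>vars := (vars s')(Mask := S)\<rparr>))"
      using I forcing size S'
      by (auto simp: I_def body_def less_Suc_eq minimum_zero_forcing_set_def position_def)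
  qed
  then have "I (2 ^ n) (sem find_positions s)"
    by (simp add: find_positions_def body_def s0_def[symmetric] masks del: sem.simps(8))
  then show "minimum_stored G n (sem find_positions s)"
    and "vars (sem find_positions s) Count = length (filter (minimum_mask G) [0..<2 ^ n])"
    using size by (auto simp: I_def minimum_stored_def position_def)
qed

lemma minimum_stored_vars [simp]:
  "f Order = vars s Order \<Longrightarrow> f Masks = vars s Masks \<Longrightarrow>
   minimum_stored G n (s\<lparr>vars := f\<rparr>) = minimum_stored G n s"
  by (simp add: minimum_stored_def)

lemma minimum_stored_outs [simp]: "minimum_stored G n (s\<lparr>outs := os\<rparr>) = minimum_stored G n s"
  by (simp add: minimum_stored_def)

lemma minimum_stored_sem:
  assumes "{Order, Masks} \<inter> written_vars c = {}"
    "{Power, Adjacent, Cardinality, Minimum, Position} \<inter> written_arrs c = {}"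
  shows "minimum_stored G n (sem c s) = minimum_stored G n s"
  using assms by (simp add: minimum_stored_def graph_stored_sem arrs_sem)

definition elements :: "nat \<Rightarrow> nat \<Rightarrow> nat list" where
  "elements n S = filter (\<lambda>i. i \<in> set_decode S) [0..<n]"

lemma print_vertices_correct:
  assumes stored: "minimum_stored G n s"
  shows "outs (sem print_vertices s) = outs s @ vars s Count #
    concat (map (\<lambda>S. card (set_decode S) # elements n S) (filter (minimum_mask G) [0..<2 ^ n]))"
proof -
  define row where "row = For Idx Order (Cond (Elem Bit (Var Idx)) (Output (Var Idx)) (Skip :: cmd))"
  define body where "body = Cond (Elem Minimum (Var Mask))
      (Output (Elem Cardinality (Var Mask)) ;; bits Bit Mask ;; row) Skip"
  define out where "out k = concat (map (\<lambda>S. card (set_decode S) # elements n S)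
      (filter (minimum_mask G) [0..<k]))" for k
  define I where "I k s' \<longleftrightarrow> minimum_stored G n s' \<and> outs s' = outs s @ vars s Count # out k"
    for k and s' :: st
  define s0 where "s0 = s\<lparr>outs := outs s @ [vars s Count]\<rparr>"
  have masks: "vars s0 Masks = 2 ^ n"
    using stored by (simp add: minimum_stored_def graph_stored_def s0_def)
  have "I (vars s0 Masks) (sem (For Mask Masks body) s0)"
  proof (rule sem_For_induct)
    show "I 0 s0"
      using stored by (simp add: I_def s0_def out_def)
  next
    fix S s' assume S: "S < vars s0 Masks" and I: "I S s'"
    have S': "S < 2 ^ n"
      using S masks by simp
    let ?s = "s'\<lparr>vars := (vars s')(Mask := S)\<rparr>"
    show "I (Suc S) (sem body ?s)"
    proof (cases "minimum_mask G S")
      case False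
      then have "sem body ?s = ?s"
        using I S' by (simp add: I_def body_def minimum_stored_def)
      with False I show ?thesis
        by (simp add: I_def out_def)
    next
      case True
      define s1 where "s1 = sem (bits Bit Mask) (?s\<lparr>outs := outs s' @ [card (set_decode S)]\<rparr>)"
      have s1: "minimum_stored G n s1" "outs s1 = outs s' @ [card (set_decode S)]"
        "\<forall>i<n. arrs s1 Bit i = of_bool (i \<in> set_decode S)"
        using I S' bits_stored[of G n "?s\<lparr>outs := outs s' @ [card (set_decode S)]\<rparr>" Mask Bit]
        by (auto simp: s1_def I_def minimum_stored_sem outs_sem minimum_stored_def[of _ _ s'])
      define J where "J k t \<longleftrightarrow> arrs t = arrs s1 \<and> outs t = outs s1 @ elements k S" for k and t :: st
      have n: "vars s1 Order = n"
        using s1 by (simp add: minimum_stored_def graph_stored_def)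
      have "J (vars s1 Order) (sem row s1)"
        unfolding row_def
      proof (rule sem_For_induct)
        show "J 0 s1"
          by (simp add: J_def elements_def)
      next
        fix i t assume "i < vars s1 Order" "J i t"
        then show "J (Suc i) (sem (Cond (Elem Bit (Var Idx)) (Output (Var Idx)) Skip)
            (t\<lparr>vars := (vars t)(Idx := i)\<rparr>))"
          using s1 n by (simp add: J_def elements_def)
      qed
      moreover have "sem body ?s = sem row s1"
        using I S' True by (simp add: body_def s1_def I_def minimum_stored_def)
      moreover have "minimum_stored G n (sem row s1)"
        using s1 by (subst minimum_stored_sem) (auto simp: row_def)
      ultimately show ?thesis
        using I s1 n True by (simp add: I_def J_def out_def)
    qed
  qed
  then show ?thesis
    by (simp add: print_vertices_def body_def row_def I_def out_def s0_def[symmetric] masks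
        del: sem.simps(8))
qed

section \<open>Edges of the zero forcing graph\<close>

definition adjacent_masks :: "nat graph \<Rightarrow> nat \<Rightarrow> nat \<Rightarrow> bool" where
  "adjacent_masks G S T \<longleftrightarrow> minimum_mask G S \<and> minimum_mask G T \<and> S < T \<and>
     card (sym_diff (set_decode S) (set_decode T)) = 2"

definition pairs_stored :: "nat graph \<Rightarrow> (nat \<times> nat) list \<Rightarrow> st \<Rightarrow> bool" where
  "pairs_stored G ps s \<longleftrightarrow> vars s Length = length ps \<and>
     (\<forall>i<length ps. arrs s Source i = position G (fst (ps ! i)) \<and>
        arrs s Target i = position G (snd (ps ! i)))"

lemma pairs_stored_vars [simp]:
  "f Length = vars s Length \<Longrightarrow> pairs_stored G ps (s\<lparr>vars := f\<rparr>) = pairs_stored G ps s"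
  by (simp add: pairs_stored_def)

lemma test_edge_correct:
  assumes stored: "minimum_stored G n s" and pairs: "pairs_stored G ps s"
    and S: "vars s Mask = S" "S < 2 ^ n" and T: "vars s Mask' = T" "T < 2 ^ n"
  shows "pairs_stored G (if adjacent_masks G S T then ps @ [(S, T)] else ps) (sem test_edge s)"
proof (cases "minimum_mask G S \<and> minimum_mask G T \<and> S < T")
  case False
  then have "sem test_edge s = s"
    using stored S T by (auto simp: test_edge_def minimum_stored_def)
  with False pairs show ?thesis
    by (auto simp: adjacent_masks_def)
next
  case True
  let ?A = "set_decode S" and ?B = "set_decode T"
  define diff :: expr where "diff = Plus (Minus (Elem Bit (Var Idx)) (Elem Bit' (Var Idx)))
      (Minus (Elem Bit' (Var Idx)) (Elem Bit (Var Idx)))"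
  define count where "count = For Idx Order (Assign Size (Plus (Var Size) diff))"
  define emit :: cmd where "emit = Update Source (Var Length) (Elem Position (Var Mask)) ;;
      Update Target (Var Length) (Elem Position (Var Mask')) ;;
      Assign Length (Plus (Var Length) (Num 1))"
  define s1 where "s1 = sem (bits Bit Mask) s"
  define s2 where "s2 = sem (bits Bit' Mask') s1"
  define s3 where "s3 = sem count (s2\<lparr>vars := (vars s2)(Size := 0)\<rparr>)"
  have gs: "graph_stored G n s"
    using stored by (simp add: minimum_stored_def)
  have s1: "graph_stored G n s1" "vars s1 Mask' = T"
    "\<forall>i<n. arrs s1 Bit i = of_bool (i \<in> ?A)"
    using gs S T bits_stored[of G n s Mask Bit]
    by (auto simp: s1_def graph_stored_sem vars_sem)
  have s2: "graph_stored G n s2" "\<forall>i<n. arrs s2 Bit i = of_bool (i \<in> ?A)"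
    "\<forall>i<n. arrs s2 Bit' i = of_bool (i \<in> ?B)"
    using s1 T bits_stored[of G n s1 Mask' Bit']
    by (auto simp: s2_def graph_stored_sem vars_sem arrs_sem)
  have "vars s3 Size = (\<Sum>i<n. of_bool (i \<in> sym_diff ?A ?B))"
    unfolding s3_def count_def using s2
    by (intro sem_sum_loop) (auto simp: graph_stored_def diff_def)
  also have "\<dots> = card (sym_diff ?A ?B)"
  proof -
    have "sym_diff ?A ?B \<subseteq> {..<n}"
      using S T set_decode_subset_iff[of _ n] by blast
    then show ?thesis
      by (simp only: sum_of_bool_eq finite_lessThan Collect_mem_eq Int_absorb1 of_nat_id)
  qed
  finally have s3: "vars s3 Size = card (sym_diff ?A ?B)" "minimum_stored G n s3"
    "pairs_stored G ps s3" "vars s3 Mask = S" "vars s3 Mask' = T"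
    using stored pairs S T by (auto simp: s1_def s2_def s3_def count_def minimum_stored_sem
        pairs_stored_def vars_sem arrs_sem simp del: sem.simps)
  have "sem test_edge s = sem (when_eq (Var Size) (Num 2) emit) s3"
    using True stored S T
    by (simp add: test_edge_def diff_def count_def emit_def s1_def s2_def s3_def minimum_stored_def)
  then show ?thesis
    using True s3 S T
    by (auto simp: adjacent_masks_def emit_def pairs_stored_def minimum_stored_def nth_append less_Suc_eq)
qed

text \<open>The product enumerates pairs in the order of the two nested loops. The first range has
  its own bound because it grows with the outer loop while the second is always run through
  completely.\<close>

definition mask_edges :: "nat graph \<Rightarrow> nat \<Rightarrow> nat \<Rightarrow> (nat \<times> nat) list" where
  "mask_edges G k m = filter (\<lambda>(S, T). adjacent_masks G S T) (List.product [0..<k] [0..<m])"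

lemma find_edges_correct:
  assumes stored: "minimum_stored G n s"
  shows "pairs_stored G (mask_edges G (2 ^ n) (2 ^ n)) (sem find_edges s)"
proof -
  define row where "row S k = filter (\<lambda>(S, T). adjacent_masks G S T) (map (Pair S) [0..<k])" for S k
  define s0 where "s0 = s\<lparr>vars := (vars s)(Length := 0)\<rparr>"
  define I where "I k t \<longleftrightarrow> minimum_stored G n t \<and> pairs_stored G (mask_edges G k (2 ^ n)) t"
    for k and t :: st
  have "I (vars s0 Masks) (sem (For Mask Masks (For Mask' Masks test_edge)) s0)"
  proof (rule sem_For_induct)
    show "I 0 s0"
      using stored by (simp add: I_def s0_def mask_edges_def pairs_stored_def)
  next
    fix S t assume S: "S < vars s0 Masks" and I: "I S t"
    let ?t = "t\<lparr>vars := (vars t)(Mask := S)\<rparr>"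
    have S': "S < 2 ^ n"
      using S stored by (simp add: s0_def minimum_stored_def graph_stored_def)
    define J where "J k t \<longleftrightarrow> minimum_stored G n t \<and> vars t Mask = S \<and>
      pairs_stored G (mask_edges G S (2 ^ n) @ row S k) t" for k and t :: st
    have masks: "vars ?t Masks = 2 ^ n"
      using I by (simp add: I_def minimum_stored_def graph_stored_def)
    have "J (vars ?t Masks) (sem (For Mask' Masks test_edge) ?t)"
    proof (rule sem_For_induct)
      show "J 0 ?t"
        using I by (simp add: I_def J_def row_def)
    next
      fix T u assume T: "T < vars ?t Masks" and J: "J T u"
      let ?u = "u\<lparr>vars := (vars u)(Mask' := T)\<rparr>"
      have "pairs_stored G (if adjacent_masks G S T then (mask_edges G S (2 ^ n) @ row S T) @ [(S, T)]
          else mask_edges G S (2 ^ n) @ row S T) (sem test_edge ?u)"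
        using J T S' masks by (intro test_edge_correct[where n = n]) (auto simp: J_def)
      moreover have "minimum_stored G n (sem test_edge ?u)" "vars (sem test_edge ?u) Mask = S"
        using J by (auto simp: J_def minimum_stored_sem vars_sem)
      ultimately show "J (Suc T) (sem test_edge ?u)"
        by (auto simp: J_def row_def split: if_splits)
    qed
    then have "J (2 ^ n) (sem (For Mask' Masks test_edge) ?t)"
      by (simp only: masks)
    moreover have "mask_edges G (Suc S) (2 ^ n) = mask_edges G S (2 ^ n) @ row S (2 ^ n)"
      by (simp add: mask_edges_def row_def product_concat_map)
    ultimately show "I (Suc S) (sem (For Mask' Masks test_edge) ?t)"
      unfolding I_def J_def by simp
  qed
  moreover have "vars s0 Masks = 2 ^ n"
    using stored by (simp add: minimum_stored_def graph_stored_def s0_def)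
  ultimately show ?thesis
    unfolding I_def find_edges_def by (simp add: s0_def del: sem.simps(8))
qed

lemma print_edges_correct:
  assumes pairs: "pairs_stored G ps s"
  shows "outs (sem print_edges s) = outs s @ encode_pairs (map (map_prod (position G) (position G)) ps)"
proof -
  define qs where "qs = map (map_prod (position G) (position G)) ps"
  define s0 where "s0 = s\<lparr>outs := outs s @ [length qs]\<rparr>"
  define I where "I k t \<longleftrightarrow> arrs t = arrs s \<and>
      outs t = outs s @ length qs # concat (map (\<lambda>(u, v). [u, v]) (take k qs))" for k and t :: st
  have len: "vars s Length = length qs"
    using pairs by (simp add: pairs_stored_def qs_def)
  have "I (vars s0 Length)
      (sem (For Idx Length (Output (Elem Source (Var Idx)) ;; Output (Elem Target (Var Idx)))) s0)"
  proof (rule sem_For_induct)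
    show "I 0 s0"
      by (simp add: I_def s0_def)
  next
    fix k t assume k: "k < vars s0 Length" and I: "I k t"
    have k': "k < length qs"
      using k len by (simp add: s0_def)
    then have "arrs s Source k = fst (qs ! k)" "arrs s Target k = snd (qs ! k)"
      using pairs by (auto simp: pairs_stored_def qs_def)
    with I k' show "I (Suc k) (sem (Output (Elem Source (Var Idx)) ;; Output (Elem Target (Var Idx)))
        (t\<lparr>vars := (vars t)(Idx := k)\<rparr>))"
      by (simp add: I_def take_Suc_conv_app_nth case_prod_unfold)
  qed
  moreover have "vars s0 Length = length qs"
    using len by (simp add: s0_def)
  ultimately show ?thesis
    by (simp add: I_def print_edges_def encode_pairs_def qs_def s0_def len del: sem.simps(8))
qed

section \<open>Reading the input\<close>

lemma read_order_correct:
  fixes s :: st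
  assumes s: "s = initial_state (n # xs)"
  shows "vars (sem read_order s) Order = n" "vars (sem read_order s) Masks = 2 ^ n"
    "\<forall>i<n. arrs (sem read_order s) Power i = 2 ^ i" "arrs (sem read_order s) Adjacent = (\<lambda>_. 0)"
    "ins (sem read_order s) = xs" "outs (sem read_order s) = []"
proof -
  define body :: cmd where
    "body = Update Power (Var Idx) (Var Masks) ;; Assign Masks (Plus (Var Masks) (Var Masks))"
  define s0 where "s0 = s\<lparr>vars := (vars s)(Order := n, Masks := 1), ins := xs\<rparr>"
  define I where "I k t \<longleftrightarrow> vars t Order = n \<and> vars t Masks = 2 ^ k \<and>
      (\<forall>i<k. arrs t Power i = 2 ^ i) \<and> arrs t Adjacent = (\<lambda>_. 0) \<and> ins t = xs \<and> outs t = []"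
    for k and t :: st
  have "I (vars s0 Order) (sem (For Idx Order body) s0)"
    by (rule sem_For_induct) (auto simp: I_def s0_def s initial_state_def body_def less_Suc_eq)
  moreover have "vars s0 Order = n"
    by (simp add: s0_def)
  moreover have "sem (Assign Masks (Num 1)) (sem (Input Order) s) = s0"
    by (simp add: s0_def s initial_state_def)
  then have "sem (For Idx Order body) s0 = sem read_order s"
    by (simp only: read_order_def body_def sem.simps(6))
  ultimately have "I n (sem read_order s)"
    by (simp only:)
  then show "vars (sem read_order s) Order = n" "vars (sem read_order s) Masks = 2 ^ n"
    "\<forall>i<n. arrs (sem read_order s) Power i = 2 ^ i" "arrs (sem read_order s) Adjacent = (\<lambda>_. 0)"
    "ins (sem read_order s) = xs" "outs (sem read_order s) = []"
    by (simp_all add: I_def)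
qed

text \<open>During the loop the table is described by its raw keys. That a key determines its edge
  is used only afterwards, where the absence of loops in a simple graph provides the different ends
  that uniqueness requires.\<close>

lemma read_edges_correct:
  assumes G: "simple_graph G" "verts G = {..<n}" and es: "lists_edges es (edges G)"
    and n: "vars s Order = n" and masks: "vars s Masks = 2 ^ n"
    and pow: "\<forall>i<n. arrs s Power i = 2 ^ i" and adj: "arrs s Adjacent = (\<lambda>_. 0)"
    and ins: "ins s = encode_pairs es"
  shows "graph_stored G n (sem read_edges s)" "outs (sem read_edges s) = outs s"
proof -
  have mem: "{u, v} \<in> edges G" "u < n" "v < n" "u \<noteq> v" if "(u, v) \<in> set es" for u v
  proof -
    show "{u, v} \<in> edges G"
      using es that by (force simp: lists_edges_def)
    then have "{u, v} \<subseteq> {..<n}" "card {u, v} = 2"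
      using G by (auto simp: simple_graph_def)
    then show "u < n" "v < n" "u \<noteq> v"
      by auto
  qed
  define body :: cmd where "body = Input Vertex ;; Input Nbr ;;
      Update Adjacent (Plus (Elem Power (Var Vertex)) (Elem Power (Var Nbr))) (Num 1)"
  define s0 where "s0 = s\<lparr>vars := (vars s)(Length := length es),
      ins := concat (map (\<lambda>(u, v). [u, v]) es)\<rparr>"
  define I where "I k t \<longleftrightarrow> vars t Order = n \<and> vars t Masks = 2 ^ n \<and>
      (\<forall>i<n. arrs t Power i = 2 ^ i) \<and> ins t = concat (map (\<lambda>(u, v). [u, v]) (drop k es)) \<and>
      (\<forall>j. arrs t Adjacent j = of_bool (\<exists>(u, v)\<in>set (take k es). j = 2 ^ u + 2 ^ v))"
    for k and t :: st
  have "I (vars s0 Length) (sem (For Idx Length body) s0)"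
  proof (rule sem_For_induct)
    show "I 0 s0"
      using n masks pow adj by (simp add: I_def s0_def)
  next
    fix k t assume "k < vars s0 Length" and I: "I k t"
    then have k: "k < length es"
      by (simp add: s0_def)
    obtain u v where uv: "es ! k = (u, v)"
      by (cases "es ! k")
    then have "u < n" "v < n"
      using mem k nth_mem by metis+
    moreover have "ins t = u # v # concat (map (\<lambda>(u, v). [u, v]) (drop (Suc k) es))"
      using I k uv by (simp add: I_def Cons_nth_drop_Suc[symmetric])
    moreover have "vars t Order = n" "vars t Masks = 2 ^ n" "\<forall>i<n. arrs t Power i = 2 ^ i"
      "\<forall>j. arrs t Adjacent j = of_bool (\<exists>(u, v)\<in>set (take k es). j = 2 ^ u + 2 ^ v)"
      using I by (simp_all add: I_def)
    ultimately show "I (Suc k) (sem body (t\<lparr>vars := (vars t)(Idx := k)\<rparr>))"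
      using uv k by (simp add: I_def body_def take_Suc_conv_app_nth)
  qed
  moreover have "vars s0 Length = length es"
    by (simp add: s0_def)
  moreover have "sem (Input Length) s = s0"
    using ins by (simp add: s0_def encode_pairs_def)
  then have "sem (For Idx Length body) s0 = sem read_edges s"
    by (simp only: read_edges_def body_def sem.simps(6))
  ultimately have I: "I (length es) (sem read_edges s)"
    by (simp only:)
  have "(\<exists>(a, b)\<in>set es. 2 ^ u + 2 ^ w = (2::nat) ^ a + 2 ^ b) \<longleftrightarrow> {u, w} \<in> edges G"
    if "u \<noteq> w" for u w
  proof -
    have "(\<exists>(a, b)\<in>set es. 2 ^ u + 2 ^ w = (2::nat) ^ a + 2 ^ b) \<longleftrightarrow>
        (\<exists>(a, b)\<in>set es. {u, w} = {a, b})"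
    proof (rule bex_cong[OF refl])
      fix p assume p: "p \<in> set es"
      obtain a b where ab: "p = (a, b)"
        by (cases p)
      then have "a \<noteq> b"
        using mem(4) p by blast
      then show "(case p of (a, b) \<Rightarrow> 2 ^ u + 2 ^ w = (2::nat) ^ a + 2 ^ b) \<longleftrightarrow>
          (case p of (a, b) \<Rightarrow> {u, w} = {a, b})"
        unfolding ab prod.case by (rule power_sum_eq_iff[OF that])
    qed
    also have "\<dots> \<longleftrightarrow> {u, w} \<in> edges G"
      using es unfolding lists_edges_def image_set[symmetric] by (auto simp: image_iff case_prod_unfold)
    finally show ?thesis .
  qed
  with I show "graph_stored G n (sem read_edges s)"
    by (simp add: I_def graph_stored_def)
  show "outs (sem read_edges s) = outs s"
    by (rule outs_sem) simp
qed

section \<open>The lower bound\<close>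

definition matching_graph :: "nat \<Rightarrow> nat graph" where
  "matching_graph n = ({..<n}, (\<lambda>i. {i, i + n div 2}) ` {..<n div 2})"

lemma matching_graph_simple: "simple_graph (matching_graph n)"
  by (auto simp: simple_graph_def matching_graph_def card_insert_if)

lemma matching_edge_iff:
  "{u, w} \<in> edges (matching_graph n) \<longleftrightarrow>
     (u < n div 2 \<and> w = u + n div 2) \<or> (w < n div 2 \<and> u = w + n div 2)"
  by (auto simp: matching_graph_def doubleton_eq_iff)

text \<open>\<open>X\<close> is closed under taking neighbors. A vertex of \<open>X\<close> could
  only be forced by a blue neighbor, which would itself lie in \<open>X\<close>.\<close>

lemma white_stays_white:
  assumes "(color_change G)\<^sup>*\<^sup>* B S" "X \<inter> B = {}"
    and "\<And>u w. w \<in> X \<Longrightarrow> {u, w} \<in> edges G \<Longrightarrow> u \<in> X"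
  shows "X \<inter> S = {}"
  using assms(1)
proof (induction rule: rtranclp_induct)
  case (step S S')
  then show ?case
    using assms(3) by (fastforce simp: color_change_def)
qed (use assms(2) in simp)

text \<open>Every component meets \<open>B\<close>, and the components are indexed by the
  \<open>n - n div 2\<close> vertices from \<open>n div 2\<close> on: upper ends of edges and, for
  odd n, the isolated vertex.\<close>

lemma matching_zfs_lower:
  assumes B: "zero_forcing_set (matching_graph n) B"
  shows "n - n div 2 \<le> card B"
proof -
  let ?m = "n div 2"
  have V: "verts (matching_graph n) = {..<n}"
    by (simp add: matching_graph_def)
  have reach: "(color_change (matching_graph n))\<^sup>*\<^sup>* B {..<n}" and "B \<subseteq> {..<n}"
    using B V by (auto simp: zero_forcing_set_def)
  have hit: "j \<in> B \<or> (j < 2 * ?m \<and> j - ?m \<in> B)" if j: "?m \<le> j" "j < n" for j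
  proof (rule ccontr)
    assume neg: "\<not> ?thesis"
    \<comment> \<open>The component of j; if it is white initially, it remains so.\<close>
    let ?X = "if j < 2 * ?m then {j - ?m, j} else {j}"
    have "?X \<inter> {..<n} = {}"
      by (rule white_stays_white[OF reach])
        (use neg j in \<open>auto simp: matching_edge_iff split: if_splits\<close>)
    then show False
      using j by (auto split: if_splits)
  qed
  \<comment> \<open>A representative in \<open>B\<close> of the component of j. It is injective,
    since values of the first kind are at least \<open>n div 2\<close> and those of the second kind
    are smaller.\<close>
  let ?f = "\<lambda>j. if j \<in> B then j else j - ?m"
  have "inj_on ?f {?m..<n}"
    by (rule inj_onI) (use hit in \<open>force split: if_splits\<close>)
  moreover have "?f ` {?m..<n} \<subseteq> B"
    using hit by force
  ultimately have "card {?m..<n} \<le> card B"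
    using \<open>B \<subseteq> {..<n}\<close> by (intro card_inj_on_le[of ?f]) (auto intro: finite_subset)
  then show ?thesis
    by simp
qed

text \<open>\<open>A\<close> consists of the edges represented by their lower end. The last interval
  is empty for even n and contains just the isolated vertex for odd n.\<close>

definition transversal :: "nat \<Rightarrow> nat set \<Rightarrow> nat set" where
  "transversal n A = A \<union> (\<lambda>i. i + n div 2) ` ({..<n div 2} - A) \<union> {2 * (n div 2)..<n}"

text \<open>A white vertex is matched, and its partner belongs to the transversal, hence is blue and
  can force it, having no other neighbor. Passing to all blue sets that contain the transversal
  allows induction on the number of white vertices.\<close>

lemma transversal_zfs:
  assumes A: "A \<subseteq> {..<n div 2}"
  shows "zero_forcing_set (matching_graph n) (transversal n A)"
proof -
  let ?G = "matching_graph n" and ?m = "n div 2"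
  have V: "verts ?G = {..<n}"
    by (simp add: matching_graph_def)
  have "(color_change ?G)\<^sup>*\<^sup>* S {..<n}" if "transversal n A \<subseteq> S" "S \<subseteq> {..<n}" for S
    using that
  proof (induction "card ({..<n} - S)" arbitrary: S rule: less_induct)
    case less
    show ?case
    proof (cases "S = {..<n}")
      case False
      then obtain w where w: "w < n" "w \<notin> S"
        using less.prems by blast
      have w2: "w < 2 * ?m"
      proof (rule ccontr)
        assume "\<not> w < 2 * ?m"
        then have "w \<in> transversal n A"
          using w by (simp add: transversal_def)
        then show False
          using w less.prems by blast
      qed
      have w3: "w \<notin> transversal n A"
        using w less.prems by blast
      define u where "u = (if w < ?m then w + ?m else w - ?m)"
      have "u \<in> transversal n A"
      proof (cases "w < ?m")
        case True
        then show ?thesis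
          using w3 by (auto simp: transversal_def u_def)
      next
        case False
        with w2 obtain v where "w = v + ?m" "v < ?m"
          by (intro that[of "w - ?m"]) auto
        then show ?thesis
          using w3 by (auto simp: transversal_def u_def)
      qed
      then have "u \<in> S"
        using less.prems by blast
      moreover have "{x \<in> verts ?G - S. {u, x} \<in> edges ?G} = {w}"
        using w w2 unfolding V matching_edge_iff by (auto simp: u_def)
      ultimately have cc: "color_change ?G S (insert w S)"
        unfolding color_change_def by blast
      have "card ({..<n} - insert w S) < card ({..<n} - S)"
        using w by (intro psubset_card_mono) auto
      then have "(color_change ?G)\<^sup>*\<^sup>* (insert w S) {..<n}"
        by (rule less.hyps) (use less.prems w in auto)
      with cc show ?thesis
        by (rule converse_rtranclp_into_rtranclp)
    qed simp
  qed
  moreover have "transversal n A \<subseteq> {..<n}"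
    using A by (auto simp: transversal_def)
  ultimately show ?thesis
    by (simp add: zero_forcing_set_def V)
qed

lemma card_transversal:
  assumes A: "A \<subseteq> {..<n div 2}"
  shows "card (transversal n A) = n - n div 2"
proof -
  let ?m = "n div 2"
  have fin: "finite A"
    using A finite_subset by blast
  have "card (A \<union> (\<lambda>i. i + ?m) ` ({..<?m} - A)) = card A + card ((\<lambda>i. i + ?m) ` ({..<?m} - A))"
    using A fin by (intro card_Un_disjoint) auto
  also have "card ((\<lambda>i. i + ?m) ` ({..<?m} - A)) = ?m - card A"
    using A fin by (subst card_image) (auto simp: card_Diff_subset)
  also have "card A + (?m - card A) = ?m"
    using card_mono[OF _ A] by simp
  finally have "card (A \<union> (\<lambda>i. i + ?m) ` ({..<?m} - A)) = ?m" .
  moreover have "card (transversal n A) =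
      card (A \<union> (\<lambda>i. i + ?m) ` ({..<?m} - A)) + card {2 * ?m..<n}"
    unfolding transversal_def using A fin by (intro card_Un_disjoint) auto
  ultimately show ?thesis
    by simp
qed

lemma transversal_minimum:
  assumes "A \<subseteq> {..<n div 2}"
  shows "minimum_zero_forcing_set (matching_graph n) (transversal n A)"
proof -
  have "zero_forcing_number (matching_graph n) = n - n div 2"
    unfolding zero_forcing_number_def
    by (rule Least_equality)
      (use transversal_zfs[OF assms] card_transversal[OF assms] matching_zfs_lower in blast)+
  then show ?thesis
    using assms by (simp add: minimum_zero_forcing_set_def transversal_zfs card_transversal)
qed

lemma inj_on_transversal: "inj_on (transversal n) (Pow {..<n div 2})"
proof (rule inj_on_inverseI)
  fix A assume "A \<in> Pow {..<n div 2}"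
  then show "transversal n A \<inter> {..<n div 2} = A"
    by (auto simp: transversal_def)
qed

section \<open>Output length against running time\<close>

lemma length_outp_run: "length (outp (run P xs t)) \<le> t"
proof (induction t)
  case (Suc t)
  have "length (outp (exec i c)) \<le> Suc (length (outp c))" for i c
    by (cases i) auto
  then have "length (outp (step P c)) \<le> Suc (length (outp c))" for c
    by (simp add: step_def)
  from this[of "run P xs t"] Suc show ?case
    by (simp add: run_def)
qed (simp add: run_def)

text \<open>Each vertex contributes at least its cardinality entry, even if it is the empty set.
  Finiteness follows from the mere existence of a listing and is what permits comparing
  cardinalities with the family of transversals.\<close>

lemma length_graph_outputs:
  assumes "ys \<in> graph_outputs H"
  shows "finite (verts H)" "card (verts H) < length ys"
proof -
  from assms obtain Bs ps where
    ys: "ys = length Bs # concat (map (\<lambda>B. length B # B) Bs) @ encode_pairs ps"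
    and Bs: "set (map set Bs) = verts H"
    unfolding graph_outputs_def by blast
  show "finite (verts H)"
    by (metis Bs List.finite_set)
  have "card (verts H) \<le> length Bs"
    by (metis Bs card_length length_map)
  also have "length Bs \<le> length (concat (map (\<lambda>B. length B # B) Bs))"
    by (induction Bs) auto
  finally show "card (verts H) < length ys"
    by (simp add: ys)
qed

lemma worst_case_time_lower:
  assumes P: "computes_zero_forcing_graph P"
  shows "2 ^ (n div 2) \<le> worst_case_time P n"
proof -
  let ?G = "matching_graph n"
  have V: "verts ?G = {..<n}"
    by (simp add: matching_graph_def)
  have fin: "finite (edges ?G)"
    by (simp add: matching_graph_def)
  have "lists_edges (map (\<lambda>i. (i, i + n div 2)) [0..<n div 2]) (edges ?G)"
    by (auto simp: lists_edges_def matching_graph_def distinct_map inj_on_def doubleton_eq_iff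
        atLeast0LessThan)
  then obtain xs where xs: "xs \<in> graph_inputs ?G"
    by (auto simp: graph_inputs_def)
  then have out: "result P xs \<in> graph_outputs (zero_forcing_graph ?G)"
    using P V matching_graph_simple unfolding computes_zero_forcing_graph_def by blast
  have "transversal n ` Pow {..<n div 2} \<subseteq> verts (zero_forcing_graph ?G)"
    by (auto simp: zero_forcing_graph_def transversal_minimum)
  then have "card (transversal n ` Pow {..<n div 2}) \<le> card (verts (zero_forcing_graph ?G))"
    by (rule card_mono[OF length_graph_outputs(1)[OF out]])
  then have "2 ^ (n div 2) \<le> card (verts (zero_forcing_graph ?G))"
    by (simp add: card_image inj_on_transversal card_Pow)
  also have "\<dots> \<le> length (result P xs)"
    using length_graph_outputs(2)[OF out] by simp
  also have "\<dots> \<le> running_time P xs"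
    unfolding result_def by (rule length_outp_run)
  also have "\<dots> \<le> worst_case_time P n"
    unfolding worst_case_time_def
  proof (rule Max_ge)
    show "running_time P xs \<in> running_time P ` inputs_of_order n"
      using xs V matching_graph_simple by (auto simp: inputs_of_order_def)
  qed (simp add: finite_inputs_of_order)
  finally show ?thesis .
qed

text \<open>For n at least 2, \<open>n div 2\<close> is at least (n - 1) / 2, which is at least n /
  4.\<close>

lemma half_bigomega: "(\<lambda>n. real (n div 2)) \<in> \<Omega>(\<lambda>n. real n)"
proof (rule landau_omega.bigI[where c = "1/4"])
  show "\<forall>\<^sub>F n in sequentially. norm (real (n div 2)) \<ge> 1/4 * norm (real n)"
    using eventually_ge_at_top[of 2] by eventually_elim (auto simp: field_simps)
qed simp

section \<open>The program is correct and runs in exponential time\<close>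

lemma set_elements: "S < 2 ^ n \<Longrightarrow> set (elements n S) = set_decode S"
  using set_decode_subset_iff[of S n] by (auto simp: elements_def)

lemma length_elements: "S < 2 ^ n \<Longrightarrow> length (elements n S) = card (set_decode S)"
  using distinct_card[of "elements n S"] by (simp add: set_elements) (simp add: elements_def)

lemma nth_position:
  assumes "minimum_mask G S" "S < m"
  shows "filter (minimum_mask G) [0..<m] ! position G S = S"
    "position G S < length (filter (minimum_mask G) [0..<m])"
proof -
  have "[0..<m] = [0..<S] @ S # [Suc S..<m]"
    using assms(2) by (metis upt_conv_Cons upt_add_eq_append le0 less_imp_le_nat le_add_diff_inverse)
  then show "filter (minimum_mask G) [0..<m] ! position G S = S"
    "position G S < length (filter (minimum_mask G) [0..<m])"
    using assms(1) by (simp_all add: position_def)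
qed

lemma output_correct:
  assumes G: "verts G = {..<n}"
  shows "length (filter (minimum_mask G) [0..<2 ^ n]) #
      concat (map (\<lambda>S. card (set_decode S) # elements n S) (filter (minimum_mask G) [0..<2 ^ n])) @
      encode_pairs (map (map_prod (position G) (position G)) (mask_edges G (2 ^ n) (2 ^ n)))
    \<in> graph_outputs (zero_forcing_graph G)"
proof -
  define L where "L = filter (minimum_mask G) [0..<2 ^ n]"
  define Bs where "Bs = map (elements n) L"
  define Q where "Q = mask_edges G (2 ^ n) (2 ^ n)"
  define ps where "ps = map (map_prod (position G) (position G)) Q"
  have minL: "S \<in> set L \<longleftrightarrow> S < 2 ^ n \<and> minimum_mask G S" for S
    by (auto simp: L_def)
  have sets: "map set Bs = map set_decode L"
    by (simp add: Bs_def minL set_elements)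
  have minimum: "minimum_zero_forcing_set G B \<longleftrightarrow> (\<exists>S\<in>set L. B = set_decode S)" for B
  proof
    assume B: "minimum_zero_forcing_set G B"
    then have "B \<subseteq> {..<n}"
      using G by (simp add: minimum_zero_forcing_set_def zero_forcing_set_def)
    then have "set_encode B < 2 ^ n" "B = set_decode (set_encode B)"
      by (simp_all add: set_encode_less_power finite_subset)
    with B minL show "\<exists>S\<in>set L. B = set_decode S"
      by metis
  qed (auto simp: minL)
  have setQ: "(S, T) \<in> set Q \<longleftrightarrow> S < 2 ^ n \<and> T < 2 ^ n \<and> adjacent_masks G S T" for S T
    by (auto simp: Q_def mask_edges_def)
  have distQ: "distinct Q"
    by (simp add: Q_def mask_edges_def distinct_product)
  have Bs_nth: "position G S < length Bs \<and> set (Bs ! position G S) = set_decode S"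
    if "S < 2 ^ n" "minimum_mask G S" for S
    using nth_position[OF that(2,1)] that by (simp add: Bs_def L_def set_elements)
  have ends: "S < 2 ^ n \<and> minimum_mask G S \<and> T < 2 ^ n \<and> minimum_mask G T" if "(S, T) \<in> set Q" for S T
    using that by (simp add: setQ adjacent_masks_def)
  have edges_eq: "map (\<lambda>(i, j). (set (Bs ! i), set (Bs ! j))) ps =
      map (\<lambda>(S, T). (set_decode S, set_decode T)) Q"
    unfolding ps_def map_map by (rule map_cong) (use ends Bs_nth in auto)
  have "lists_edges (map (\<lambda>(S, T). (set_decode S, set_decode T)) Q) (edges (zero_forcing_graph G))"
    unfolding lists_edges_def map_map
  proof
    \<comment> \<open>Two listed pairs with the same underlying set could differ only by a swap,
      which \<open>S < T\<close> excludes.\<close>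
    show "distinct (map ((\<lambda>(u, v). {u, v}) \<circ> (\<lambda>(S, T). (set_decode S, set_decode T))) Q)"
      unfolding distinct_map
      using distQ
      by (auto simp: inj_on_def doubleton_eq_iff inj_set_decode setQ adjacent_masks_def)
    show "set (map ((\<lambda>(u, v). {u, v}) \<circ> (\<lambda>(S, T). (set_decode S, set_decode T))) Q) =
        edges (zero_forcing_graph G)"
    proof (intro subset_antisym subsetI)
      fix e assume "e \<in> set (map ((\<lambda>(u, v). {u, v}) \<circ> (\<lambda>(S, T). (set_decode S, set_decode T))) Q)"
      then obtain S T where "(S, T) \<in> set Q" "e = {set_decode S, set_decode T}"
        by auto
      then show "e \<in> edges (zero_forcing_graph G)"
        by (auto simp: setQ adjacent_masks_def zero_forcing_graph_def)
    next
      fix e assume "e \<in> edges (zero_forcing_graph G)"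
      then obtain B C where e: "e = {B, C}" and "minimum_zero_forcing_set G B"
        "minimum_zero_forcing_set G C" and diff: "card (sym_diff B C) = 2"
        by (auto simp: zero_forcing_graph_def)
      then obtain S T where ST: "S \<in> set L" "B = set_decode S" "T \<in> set L" "C = set_decode T"
        unfolding minimum by blast
      \<comment> \<open>An edge is unordered, whereas \<open>Q\<close> contains only the orientation
        with the smaller mask first. As the masks differ, one of the two orientations is
        listed.\<close>
      have "S \<noteq> T"
        using diff unfolding ST by auto
      moreover have "card (sym_diff C B) = 2"
        using diff by (simp only: Un_commute)
      ultimately consider "(S, T) \<in> set Q" | "(T, S) \<in> set Q"
        using ST diff unfolding setQ adjacent_masks_def minL by (metis linorder_neqE_nat)
      then show "e \<in> set (map ((\<lambda>(u, v). {u, v}) \<circ> (\<lambda>(S, T). (set_decode S, set_decode T))) Q)"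
      proof cases
        case 1
        then show ?thesis
          unfolding e ST by (auto intro!: image_eqI)
      next
        case 2
        then show ?thesis
          unfolding e ST insert_commute[of "set_decode S"] by (auto intro!: image_eqI)
      qed
    qed
  qed
  then have "lists_edges (map (\<lambda>(i, j). (set (Bs ! i), set (Bs ! j))) ps) (edges (zero_forcing_graph G))"
    by (simp only: edges_eq)
  moreover have "\<forall>B\<in>set Bs. distinct B"
    by (auto simp: Bs_def elements_def)
  moreover have "distinct (map set Bs)"
    unfolding sets distinct_map by (auto simp: L_def inj_on_def inj_set_decode)
  moreover have "set (map set Bs) = verts (zero_forcing_graph G)"
    unfolding sets using minimum by (auto simp: zero_forcing_graph_def)
  moreover have "\<forall>(i, j)\<in>set ps. i < length Bs \<and> j < length Bs"
    using ends Bs_nth by (auto simp: ps_def)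
  moreover have "concat (map (\<lambda>S. card (set_decode S) # elements n S) L) =
      concat (map (\<lambda>B. length B # B) Bs)"
    unfolding Bs_def map_map by (intro arg_cong[where f = concat] map_cong) (auto simp: minL length_elements)
  moreover have "length L = length Bs"
    by (simp add: Bs_def)
  ultimately show ?thesis
    unfolding graph_outputs_def L_def[symmetric] Q_def[symmetric] ps_def[symmetric] by auto
qed

text \<open>The crude estimate of \<open>n * n\<close> by \<open>2 ^ n * 2 ^ n\<close> brings the
  loop that reads the edges under the same bound as the loop that prints them.\<close>

lemma length_edge_list:
  assumes G: "simple_graph G" "verts G = {..<n}" and es: "lists_edges es (edges G)"
  shows "length es \<le> 4 ^ n"
proof -
  have "distinct es"
    using es by (auto simp: lists_edges_def distinct_map)
  have "set es \<subseteq> {..<n} \<times> {..<n}"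
  proof
    fix p assume "p \<in> set es"
    then have "{fst p, snd p} \<in> edges G"
      using es by (force simp: lists_edges_def case_prod_unfold)
    then have "{fst p, snd p} \<subseteq> {..<n}"
      using G by (auto simp: simple_graph_def)
    then show "p \<in> {..<n} \<times> {..<n}"
      by (auto simp: mem_Times_iff)
  qed
  then have "card (set es) \<le> card ({..<n} \<times> {..<n})"
    by (intro card_mono) auto
  then have "length es \<le> n * n"
    using distinct_card[OF \<open>distinct es\<close>] by simp
  also have "\<dots> \<le> 2 ^ n * 2 ^ n"
    by (intro mult_mono) (auto simp: less_imp_le)
  also have "\<dots> = 4 ^ n"
    by (simp flip: power_mult_distrib)
  finally show ?thesis .
qed

text \<open>Both claims are read off the same sequence of intermediate states: the output from the
  results of the phases, the iteration bounds from the values of \<open>Order\<close>,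
  \<open>Masks\<close> and \<open>Length\<close> at the phase boundaries.\<close>

lemma zero_forcing_program_correct:
  assumes G: "simple_graph G" "verts G = {..<n}" and xs: "xs \<in> graph_inputs G"
  shows "outs (sem zero_forcing_program (initial_state xs)) \<in> graph_outputs (zero_forcing_graph G)"
    and "loops_bounded (4 ^ n) zero_forcing_program (initial_state xs)"
proof -
  obtain es where es: "lists_edges es (edges G)" and xs': "xs = n # encode_pairs es"
    using xs G by (auto simp: graph_inputs_def)
  define s0 :: st where "s0 = initial_state xs"
  define s1 where "s1 = sem read_order s0"
  define s2 where "s2 = sem read_edges s1"
  define s3 where "s3 = sem find_forcing s2"
  define s4 where "s4 = sem find_sizes s3"
  define s5 where "s5 = sem find_positions s4"
  define s6 where "s6 = sem print_vertices s5"
  define s7 where "s7 = sem find_edges s6"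
  have final: "sem zero_forcing_program s0 = sem print_edges s7"
    by (simp add: zero_forcing_program_def s1_def s2_def s3_def s4_def s5_def s6_def s7_def)
  note s1 = read_order_correct[of s0 n "encode_pairs es", folded s1_def]
  have s0': "s0 = initial_state (n # encode_pairs es)"
    by (simp add: s0_def xs')
  have s2: "graph_stored G n s2" "outs s2 = []"
    using read_edges_correct[OF G es, of s1] s1[OF s0'] by (simp_all add: s2_def)
  have s3: "graph_stored G n s3"
    "\<forall>S<2 ^ n. arrs s3 Forcing S = of_bool (zero_forcing_set G (set_decode S))"
    using find_forcing_correct[OF s2(1) G(2)] s2 by (auto simp: s3_def graph_stored_sem)
  have s4: "graph_stored G n s4"
    "\<forall>S<2 ^ n. arrs s4 Forcing S = of_bool (zero_forcing_set G (set_decode S))"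
    "\<forall>S<2 ^ n. arrs s4 Cardinality S = card (set_decode S)"
    "vars s4 Least_Size = zero_forcing_number G"
    using find_sizes_correct[OF s3(1) G(2) s3(2)] s3 by (auto simp: s4_def graph_stored_sem arrs_sem)
  have s5: "minimum_stored G n s5" "vars s5 Count = length (filter (minimum_mask G) [0..<2 ^ n])"
    "outs s5 = []"
    using find_positions_correct[OF s4] s2 by (simp_all add: s5_def s4_def s3_def outs_sem)
  have s6: "minimum_stored G n s6"
    using s5 by (simp add: s6_def minimum_stored_sem)
  note outs6 = print_vertices_correct[OF s5(1), folded s6_def, unfolded s5]
  have s7: "pairs_stored G (mask_edges G (2 ^ n) (2 ^ n)) s7" "outs s7 = outs s6"
    using find_edges_correct[OF s6] by (simp_all add: s7_def outs_sem)
  have "outs (sem zero_forcing_program s0) \<in> graph_outputs (zero_forcing_graph G)"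
    unfolding final print_edges_correct[OF s7(1)] s7(2) outs6 using output_correct[OF G(2)] by simp
  then show "outs (sem zero_forcing_program (initial_state xs)) \<in> graph_outputs (zero_forcing_graph G)"
    by (simp add: s0_def)

  have pow: "(2::nat) ^ n * 2 ^ n = 4 ^ n"
    by (simp flip: power_mult_distrib)
  have n_le: "n \<le> 4 ^ n" and pow_le: "(2::nat) ^ n \<le> 4 ^ n"
    by (auto intro: less_imp_le[OF less_exp[THEN less_le_trans]] power_mono)
  have order: "loops_bounded (4 ^ n) read_order s0"
    unfolding read_order_def loops_bounded.simps(1-7)
    by (intro conjI TrueI loops_boundedI[where X = "{Order}"]) (use n_le in \<open>auto simp: s0' initial_state_def\<close>)
  have edges: "loops_bounded (4 ^ n) read_edges s1"
    unfolding read_edges_def loops_bounded.simps(1-7)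
    by (intro conjI TrueI loops_boundedI[where X = "{Length}"])
      (use s1(5)[OF s0'] length_edge_list[OF G es] in \<open>auto simp: encode_pairs_def\<close>)
  have "loops_bounded (4 ^ n) (find_forcing ;; find_sizes ;; find_positions ;; print_vertices ;; find_edges) s2"
  proof (rule loops_boundedI[where X = "{Order, Masks}"])
    show "bound_vars (find_forcing ;; find_sizes ;; find_positions ;; print_vertices ;; find_edges)
        \<subseteq> {Order, Masks}"
      by (auto simp: find_forcing_def find_sizes_def find_positions_def print_vertices_def
          find_edges_def test_edge_def bits_def white_neighbors_def)
  qed (use s2 n_le pow_le in \<open>auto simp: graph_stored_def\<close>)
  moreover have "loops_bounded (4 ^ n) print_edges s7"
  proof -
    \<comment> \<open>The edges found are filtered from all pairs of masks; this is where
      \<open>4 ^ n\<close> originates.\<close>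
    have "vars s7 Length \<le> length (List.product [0..<(2::nat) ^ n] [0..<(2::nat) ^ n])"
      using s7(1) unfolding pairs_stored_def mask_edges_def by (metis length_filter_le)
    then have "vars s7 Length \<le> 4 ^ n"
      by (simp add: pow)
    then show ?thesis
      unfolding print_edges_def loops_bounded.simps(1-7)
      by (intro conjI TrueI loops_boundedI[where X = "{Length}"]) auto
  qed
  ultimately show "loops_bounded (4 ^ n) zero_forcing_program (initial_state xs)"
    using order edges
    by (simp add: zero_forcing_program_def s0_def[symmetric] s1_def[symmetric] s2_def[symmetric]
        s3_def[symmetric] s4_def[symmetric] s5_def[symmetric] s6_def[symmetric] s7_def[symmetric]
        del: loops_bounded.simps(8))
qed

lemma worst_case_time_upper:
  shows "\<exists>P. computes_zero_forcing_graph P \<and>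
    (\<exists>f :: nat \<Rightarrow> nat. (\<lambda>n. real (f n)) \<in> O(\<lambda>n. real n) \<and> (\<forall>n. worst_case_time P n \<le> 2 ^ f n))"
proof -
  let ?P = "compile zero_forcing_program 0 0"
  obtain K D where KD: "\<And>N. time_bound N zero_forcing_program \<le> K * (N + 1) ^ D"
    using time_bound_polynomial by blast
  \<comment> \<open>The exponent results from estimating \<open>K\<close> by \<open>2 ^ K\<close>
    and \<open>4 ^ n + 1\<close> by \<open>2 ^ (2 * n + 1)\<close>.\<close>
  define f where "f n = K + (2 * n + 1) * D" for n
  have time: "running_time ?P xs \<le> 2 ^ f n"
    if "simple_graph G" "verts G = {..<n}" "xs \<in> graph_inputs G" for G n xs
  proof -
    have "running_time ?P xs \<le> K * (4 ^ n + 1) ^ D"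
      using compiled_program(3)[OF zero_forcing_program_correct(2)[OF that]] KD[of "4 ^ n"]
      by (rule le_trans)
    also have "\<dots> \<le> 2 ^ K * (2 ^ (2 * n + 1)) ^ D"
      by (intro mult_mono power_mono) (auto simp: less_imp_le power_mult)
    also have "\<dots> = 2 ^ f n"
      by (simp add: f_def power_add power_mult)
    finally show ?thesis .
  qed
  have "computes_zero_forcing_graph ?P"
    unfolding computes_zero_forcing_graph_def
    using zero_forcing_program_correct compiled_program by metis
  moreover have "worst_case_time ?P n \<le> 2 ^ f n" for n
  proof -
    have "running_time ?P xs \<le> 2 ^ f n" if "xs \<in> inputs_of_order n" for xs
      using that time unfolding inputs_of_order_def by blast
    then show ?thesis
      unfolding worst_case_time_def
      by (intro Max.boundedI) (auto simp: finite_inputs_of_order inputs_of_order_nonempty)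
  qed
  moreover have "(\<lambda>n. real (f n)) \<in> O(\<lambda>n. real n)"
  \<comment> \<open>For n at least 1, \<open>K\<close> is at most \<open>K * n\<close> and
    \<open>2 * n + 1\<close> at most \<open>3 * n\<close>; the additional 1 keeps the constant
    positive.\<close>
  proof (rule landau_o.bigI[where c = "real (K + 3 * D + 1)"])
    show "\<forall>\<^sub>F n in sequentially. norm (real (f n)) \<le> real (K + 3 * D + 1) * norm (real n)"
      using eventually_ge_at_top[of 1]
    proof eventually_elim
      case (elim n)
      have "f n \<le> K * n + (3 * n) * D"
        unfolding f_def using elim by (intro add_mono mult_mono) auto
      also have "\<dots> \<le> (K + 3 * D + 1) * n"
        by (simp add: algebra_simps)
      finally have "real (f n) \<le> real ((K + 3 * D + 1) * n)"
        using of_nat_mono by blast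
      then show ?case
        by (simp add: algebra_simps)
    qed
  qed simp
  ultimately show ?thesis
    by blast
qed

theorem corollary6p6:
  shows "(\<exists>P. computes_zero_forcing_graph P \<and>
            (\<exists>f :: nat \<Rightarrow> nat. (\<lambda>n. real (f n)) \<in> O(\<lambda>n. real n) \<and>
               (\<forall>n. worst_case_time P n \<le> 2 ^ f n))) \<and>
         (\<forall>P. computes_zero_forcing_graph P \<longrightarrow>
            (\<exists>f :: nat \<Rightarrow> nat. (\<lambda>n. real (f n)) \<in> \<Omega>(\<lambda>n. real n) \<and>
               (\<forall>n. worst_case_time P n \<ge> 2 ^ f n)))"
proof (intro conjI allI impI)
  show "\<exists>P. computes_zero_forcing_graph P \<and>
      (\<exists>f :: nat \<Rightarrow> nat. (\<lambda>n. real (f n)) \<in> O(\<lambda>n. real n) \<and> (\<forall>n. worst_case_time P n \<le> 2 ^ f n))"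
    by (rule worst_case_time_upper)
next
  fix P assume "computes_zero_forcing_graph P"
  then show "\<exists>f :: nat \<Rightarrow> nat. (\<lambda>n. real (f n)) \<in> \<Omega>(\<lambda>n. real n) \<and>
      (\<forall>n. worst_case_time P n \<ge> 2 ^ f n)"
    using half_bigomega worst_case_time_lower by (intro exI[of _ "\<lambda>n. n div 2"]) auto
qed

end
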